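(* Let $K$ be a nonzero radical Poisson ideal of $\mathrm{S}(W_+)$. Then $$\operatorname{PGKdim}\mathrm{S}(W_+)/K=\operatorname{GKdim}\mathrm{S}(W_+)/K<\infty .$$
   Context: $\Bbbk$ is a field of characteristic zero. The positive Witt algebra $W_+$ is the Lie algebra over $\Bbbk$ with basis $\{e_n : n\in\mathbb{Z}_{\geq 1}\}$ and bracket $[e_i,e_j]=(j-i)e_{i+j}$. Its symmetric algebra $\mathrm{S}(W_+)$ is the polynomial ring $\Bbbk[x_1,x_2,\dots]$ ($x_i$ being the image of $e_i$), with the Poisson bracket determined by $\{x_i,x_j\}=(j-i)x_{i+j}$ and the Leibniz rule. A Poisson ideal is an ideal $I$ with $\{f,g\}\in I$ for all $f\in I$, $g\in\mathrm{S}(W_+)$. The Gelfand-Kirillov dimension of a $\Bbbk$-algebra $R$ is $\operatorname{GKdim}R=\sup_V\limsup_{n\to\infty}\log_n\dim_\Bbbk\left(\sum_{k=0}^nV^k\right)$, the supremum over finite-dimensional subspaces $V\subseteq R$. Poisson GK-dimension: let $A$ be a (commutative) Poisson algebra over $\Bbbk$ and $V\subseteq A$ a subspace. Define $V^{\{0\}}=\Bbbk$ and $V^{\{n+1\}}=VV^{\{n\}}+\{V,V^{\{n\}}\}$ for $n\ge 0$ (products and brackets of subspaces mean spans). For finite-dimensional $V$ put $\operatorname{pd}_V(n)=\dim_\Bbbk\left(\sum_{k=0}^nV^{\{k\}}\right)$. If $A$ is generated as a Poisson algebra by a finite-dimensional subspace $V$, then $\operatorname{PGKdim}A=\limsup_n\log_n\operatorname{pd}_V(n)$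 (independent of $V$); for arbitrary $A$, $\operatorname{PGKdim}A$ is the supremum of $\operatorname{PGKdim}A'$ over finitely generated Poisson subalgebras $A'$ of $A$. *)

theory Defs
  imports
    "Jordan_Normal_Form.VS_Connect"
    "HOL-Algebra.QuotRing"
    "HOL-Library.Poly_Mapping"
    "HOL-Library.Extended_Real"
    "HOL-Library.Liminf_Limsup"
begin

record ('a, 'b) poisson_alg = "('a, 'b) module" +
  pbracket :: "['b, 'b] \<Rightarrow> 'b" (\<open>\<lbrace>_, _\<rbrace>\<index>\<close>)

locale poisson_algebra = algebra R A
  for R :: "('a, 'r) ring_scheme" and A :: "('a, 'b, 'm) poisson_alg_scheme" (structure) +
  assumes bracket_closed: "\<lbrakk>x \<in> carrier A; y \<in> carrier A\<rbrakk> \<Longrightarrow> \<lbrace>x, y\<rbrace> \<in> carrier A"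
    and bracket_add: "\<lbrakk>x \<in> carrier A; y \<in> carrier A; z \<in> carrier A\<rbrakk>
          \<Longrightarrow> \<lbrace>x \<oplus> y, z\<rbrace> = \<lbrace>x, z\<rbrace> \<oplus> \<lbrace>y, z\<rbrace>"
    and bracket_smult: "\<lbrakk>c \<in> carrier R; x \<in> carrier A; y \<in> carrier A\<rbrakk>
          \<Longrightarrow> \<lbrace>c \<odot> x, y\<rbrace> = c \<odot> \<lbrace>x, y\<rbrace>"
    and bracket_antisym: "\<lbrakk>x \<in> carrier A; y \<in> carrier A\<rbrakk> \<Longrightarrow> \<lbrace>x, y\<rbrace> = \<ominus> \<lbrace>y, x\<rbrace>"
    and bracket_jacobi: "\<lbrakk>x \<in> carrier A; y \<in> carrier A; z \<in> carrier A\<rbrakk>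
          \<Longrightarrow> \<lbrace>x, \<lbrace>y, z\<rbrace>\<rbrace> \<oplus> \<lbrace>y, \<lbrace>z, x\<rbrace>\<rbrace> \<oplus> \<lbrace>z, \<lbrace>x, y\<rbrace>\<rbrace> = \<zero>"
    and bracket_leibniz: "\<lbrakk>x \<in> carrier A; y \<in> carrier A; z \<in> carrier A\<rbrakk>
          \<Longrightarrow> \<lbrace>x \<otimes> y, z\<rbrace> = x \<otimes> \<lbrace>y, z\<rbrace> \<oplus> y \<otimes> \<lbrace>x, z\<rbrace>"

definition poisson_ideal :: "'b set \<Rightarrow> ('a, 'b, 'm) poisson_alg_scheme \<Rightarrow> bool"
  where "poisson_ideal I A \<longleftrightarrow> ideal I A \<and> (\<forall>f\<in>I. \<forall>g\<in>carrier A. \<lbrace>f, g\<rbrace>\<^bsub>A\<^esub> \<in> I)"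

definition radical_ideal :: "'b set \<Rightarrow> ('b, 'm) ring_scheme \<Rightarrow> bool"
  where "radical_ideal I A \<longleftrightarrow>
    ideal I A \<and> (\<forall>f\<in>carrier A. \<forall>n::nat. f [^]\<^bsub>A\<^esub> n \<in> I \<longrightarrow> f \<in> I)"

text \<open>
  The quotient Poisson algebra: the ring \<^term>\<open>A Quot I\<close> of cosets, with scalar multiplication
  and bracket induced from representatives (as \<^const>\<open>rcoset_mult\<close> does for the product).
\<close>

definition poisson_quot :: "('a, 'b, 'm) poisson_alg_scheme \<Rightarrow> 'b set \<Rightarrow> ('a, 'b set) poisson_alg"
  where "poisson_quot A I =
    \<lparr>carrier = carrier (A Quot I), mult = mult (A Quot I), one = one (A Quot I),
     zero = zero (A Quot I), add = add (A Quot I),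
     smult = (\<lambda>c X. \<Union>x\<in>X. I +>\<^bsub>A\<^esub> (c \<odot>\<^bsub>A\<^esub> x)),
     pbracket = (\<lambda>X Y. \<Union>x\<in>X. \<Union>y\<in>Y. I +>\<^bsub>A\<^esub> \<lbrace>x, y\<rbrace>\<^bsub>A\<^esub>)\<rparr>"

lemma poisson_quot_algebra:
  assumes "poisson_algebra R A" and "poisson_ideal I A"
  shows "poisson_algebra R (poisson_quot A I)"
proof -
  have alg_A: "algebra R A"
    by (rule poisson_algebra.axioms(1)[OF assms(1)])
  interpret A: cring A by (rule algebra.axioms(2)[OF alg_A])
  interpret R: cring R by (rule module.axioms(1)[OF algebra.axioms(1)[OF alg_A]])
  interpret P: poisson_algebra R A by fact
  interpret I: ideal I A using assms(2) by (simp add: poisson_ideal_def)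
  note [simp] = P.bracket_closed
  let ?Q = "poisson_quot A I"
  have br_add_r: "\<lbrace>z, x \<oplus>\<^bsub>A\<^esub> y\<rbrace>\<^bsub>A\<^esub> = \<lbrace>z, x\<rbrace>\<^bsub>A\<^esub> \<oplus>\<^bsub>A\<^esub> \<lbrace>z, y\<rbrace>\<^bsub>A\<^esub>"
    if "x \<in> carrier A" "y \<in> carrier A" "z \<in> carrier A" for x y z
    using that P.bracket_antisym[of z "x \<oplus>\<^bsub>A\<^esub> y"] P.bracket_antisym[of z x]
      P.bracket_antisym[of z y] by (simp add: P.bracket_add A.minus_add)
  have Il: "\<lbrace>f, g\<rbrace>\<^bsub>A\<^esub> \<in> I" if "f \<in> I" "g \<in> carrier A" for f g
    using assms(2) that by (auto simp: poisson_ideal_def)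
  have Ir: "\<lbrace>g, f\<rbrace>\<^bsub>A\<^esub> \<in> I" if "f \<in> I" "g \<in> carrier A" for f g
    using that Il[OF that] P.bracket_antisym[of g f] by simp
  have coset_eqI: "I +>\<^bsub>A\<^esub> (a \<oplus>\<^bsub>A\<^esub> x) = I +>\<^bsub>A\<^esub> x" if "a \<in> I" "x \<in> carrier A" for a x
    using A.a_repr_independence[OF A.a_rcosI[OF that(1) I.a_subset that(2)] that(2) I.a_subgroup] by simp
  have self: "x \<in> I +>\<^bsub>A\<^esub> x" if "x \<in> carrier A" for x
    using that by (rule I.a_rcos_self)
  have mem: "\<exists>a\<in>I. x' = a \<oplus>\<^bsub>A\<^esub> x" if "x' \<in> I +>\<^bsub>A\<^esub> x" for x x'
    using that by (auto simp: a_r_coset_def' )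
  have ne: "I +>\<^bsub>A\<^esub> x \<noteq> {}" if "x \<in> carrier A" for x
    using self[OF that] by blast
  have smult_I: "c \<odot>\<^bsub>A\<^esub> a \<in> I" if "c \<in> carrier R" "a \<in> I" for c a
  proof -
    have "c \<odot>\<^bsub>A\<^esub> a = (c \<odot>\<^bsub>A\<^esub> \<one>\<^bsub>A\<^esub>) \<otimes>\<^bsub>A\<^esub> a"
      using that by (subst P.smult_assoc2) auto
    thus ?thesis using that by (simp add: I.I_l_closed)
  qed
  have carr: "carrier ?Q = {I +>\<^bsub>A\<^esub> x | x. x \<in> carrier A}"
    by (auto simp: poisson_quot_def FactRing_def A_RCOSETS_def')
  have sm: "c \<odot>\<^bsub>?Q\<^esub> (I +>\<^bsub>A\<^esub> x) = I +>\<^bsub>A\<^esub> (c \<odot>\<^bsub>A\<^esub> x)" if "c \<in> carrier R" "x \<in> carrier A" for c x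
  proof -
    have "I +>\<^bsub>A\<^esub> (c \<odot>\<^bsub>A\<^esub> x') = I +>\<^bsub>A\<^esub> (c \<odot>\<^bsub>A\<^esub> x)" if "x' \<in> I +>\<^bsub>A\<^esub> x" for x'
      using mem[OF that] \<open>c \<in> carrier R\<close> \<open>x \<in> carrier A\<close>
      by (auto simp: P.smult_r_distr coset_eqI smult_I)
    hence "(\<Union>x'\<in>I +>\<^bsub>A\<^esub> x. I +>\<^bsub>A\<^esub> (c \<odot>\<^bsub>A\<^esub> x')) = I +>\<^bsub>A\<^esub> (c \<odot>\<^bsub>A\<^esub> x)"
      by (intro SUP_eq_const ne that(2))
    thus ?thesis by (simp add: poisson_quot_def)
  qed
  have br: "\<lbrace>I +>\<^bsub>A\<^esub> x, I +>\<^bsub>A\<^esub> y\<rbrace>\<^bsub>?Q\<^esub> = I +>\<^bsub>A\<^esub> \<lbrace>x, y\<rbrace>\<^bsub>A\<^esub>" if "x \<in> carrier A" "y \<in> carrier A" for x y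
  proof -
    have "I +>\<^bsub>A\<^esub> \<lbrace>x', y'\<rbrace>\<^bsub>A\<^esub> = I +>\<^bsub>A\<^esub> \<lbrace>x, y\<rbrace>\<^bsub>A\<^esub>" if xy': "x' \<in> I +>\<^bsub>A\<^esub> x" "y' \<in> I +>\<^bsub>A\<^esub> y" for x' y'
    proof -
      obtain a b where ab: "a \<in> I" "x' = a \<oplus>\<^bsub>A\<^esub> x" "b \<in> I" "y' = b \<oplus>\<^bsub>A\<^esub> y"
        using mem[OF xy'(1)] mem[OF xy'(2)] by blast
      have "\<lbrace>x', y'\<rbrace>\<^bsub>A\<^esub> = \<lbrace>a, b \<oplus>\<^bsub>A\<^esub> y\<rbrace>\<^bsub>A\<^esub> \<oplus>\<^bsub>A\<^esub> (\<lbrace>x, b\<rbrace>\<^bsub>A\<^esub> \<oplus>\<^bsub>A\<^esub> \<lbrace>x, y\<rbrace>\<^bsub>A\<^esub>)"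
        using ab \<open>x \<in> carrier A\<close> \<open>y \<in> carrier A\<close> by (simp add: P.bracket_add[of a x "b \<oplus>\<^bsub>A\<^esub> y"] br_add_r[of b y x])
      thus ?thesis using ab \<open>x \<in> carrier A\<close> \<open>y \<in> carrier A\<close>
        by (simp add: coset_eqI Il Ir)
    qed
    hence "(\<Union>x'\<in>I +>\<^bsub>A\<^esub> x. \<Union>y'\<in>I +>\<^bsub>A\<^esub> y. I +>\<^bsub>A\<^esub> \<lbrace>x', y'\<rbrace>\<^bsub>A\<^esub>) = I +>\<^bsub>A\<^esub> \<lbrace>x, y\<rbrace>\<^bsub>A\<^esub>"
      by (intro SUP_eq_const ne that)
    thus ?thesis by (simp add: poisson_quot_def)
  qed
  have mu: "(I +>\<^bsub>A\<^esub> x) \<otimes>\<^bsub>?Q\<^esub> (I +>\<^bsub>A\<^esub> y) = I +>\<^bsub>A\<^esub> (x \<otimes>\<^bsub>A\<^esub> y)" if "x \<in> carrier A" "y \<in> carrier A" for x y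
    using that by (simp add: poisson_quot_def FactRing_def I.rcoset_mult_add)
  have ad: "(I +>\<^bsub>A\<^esub> x) \<oplus>\<^bsub>?Q\<^esub> (I +>\<^bsub>A\<^esub> y) = I +>\<^bsub>A\<^esub> (x \<oplus>\<^bsub>A\<^esub> y)" if "x \<in> carrier A" "y \<in> carrier A" for x y
    using that by (simp add: poisson_quot_def FactRing_def I.a_rcos_sum)
  have ze: "\<zero>\<^bsub>?Q\<^esub> = I +>\<^bsub>A\<^esub> \<zero>\<^bsub>A\<^esub>"
    by (simp add: poisson_quot_def FactRing_def A.a_coset_add_zero[OF I.a_subset])
  have on: "\<one>\<^bsub>?Q\<^esub> = I +>\<^bsub>A\<^esub> \<one>\<^bsub>A\<^esub>"
    by (simp add: poisson_quot_def FactRing_def)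
  have cr: "cring ?Q"
  proof (rule cringI)
    have "\<exists>Y\<in>carrier ?Q. Y \<oplus>\<^bsub>?Q\<^esub> X = \<zero>\<^bsub>?Q\<^esub>" if "X \<in> carrier ?Q" for X
    proof -
      obtain x where "x \<in> carrier A" "X = I +>\<^bsub>A\<^esub> x" using \<open>X \<in> carrier ?Q\<close> by (auto simp: carr)
      thus ?thesis by (intro bexI[of _ "I +>\<^bsub>A\<^esub> (\<ominus>\<^bsub>A\<^esub> x)"]) (auto simp: carr ad ze A.l_neg)
    qed
    thus "abelian_group ?Q"
      by (intro abelian_groupI) (auto simp: carr ad ze A.add.m_ac)
    show "comm_monoid ?Q"
      by (rule comm_monoidI) (auto simp: carr mu on A.m_ac)
    show "(x \<oplus>\<^bsub>?Q\<^esub> y) \<otimes>\<^bsub>?Q\<^esub> z = x \<otimes>\<^bsub>?Q\<^esub> z \<oplus>\<^bsub>?Q\<^esub> y \<otimes>\<^bsub>?Q\<^esub> z"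
      if "x \<in> carrier ?Q" "y \<in> carrier ?Q" "z \<in> carrier ?Q" for x y z
      using that by (auto simp: carr mu ad A.l_distr)
  qed
  have alg: "algebra R ?Q"
    by (rule algebraI[OF R.cring_axioms cr])
       (auto simp: carr sm ad mu P.smult_l_distr P.smult_r_distr P.smult_assoc1 P.smult_assoc2)
  interpret Q: cring ?Q by (rule cr)
  have neg: "\<ominus>\<^bsub>?Q\<^esub> (I +>\<^bsub>A\<^esub> x) = I +>\<^bsub>A\<^esub> (\<ominus>\<^bsub>A\<^esub> x)" if "x \<in> carrier A" for x
    by (rule Q.minus_equality) (use that in \<open>auto simp: carr ad ze A.l_neg\<close>)
  have anti: "\<lbrace>X, Y\<rbrace>\<^bsub>?Q\<^esub> = \<ominus>\<^bsub>?Q\<^esub> \<lbrace>Y, X\<rbrace>\<^bsub>?Q\<^esub>" if XY: "X \<in> carrier ?Q" "Y \<in> carrier ?Q" for X Y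
  proof -
    obtain x y where "x \<in> carrier A" "y \<in> carrier A" "X = I +>\<^bsub>A\<^esub> x" "Y = I +>\<^bsub>A\<^esub> y"
      using XY by (auto simp: carr)
    thus ?thesis by (simp add: br neg P.bracket_antisym[of x y])
  qed
  show ?thesis
    by (intro poisson_algebra.intro poisson_algebra_axioms.intro alg anti)
      (auto simp: carr sm ad mu br ze P.bracket_add P.bracket_smult
        P.bracket_jacobi P.bracket_leibniz)
qed

definition fin_dim_subspace ::
    "('a, 'r) ring_scheme \<Rightarrow> 'b set \<Rightarrow> ('a, 'b, 'm) module_scheme \<Rightarrow> bool"
  where "fin_dim_subspace R V A \<longleftrightarrow>
    VectorSpace.subspace R V A \<and> vectorspace.fin_dim R (A\<lparr>carrier := V\<rparr>)"

definition subspace_dim ::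
    "('a, 'r) ring_scheme \<Rightarrow> ('a, 'b, 'm) module_scheme \<Rightarrow> 'b set \<Rightarrow> nat"
  where "subspace_dim R A V = vectorspace.dim R (A\<lparr>carrier := V\<rparr>)"

definition span_mult ::
    "('a, 'r) ring_scheme \<Rightarrow> ('a, 'b, 'm) module_scheme \<Rightarrow> 'b set \<Rightarrow> 'b set \<Rightarrow> 'b set"
  where "span_mult R A U W = LinearCombinations.module.span R A {u \<otimes>\<^bsub>A\<^esub> w |u w. u \<in> U \<and> w \<in> W}"

definition span_bracket ::
    "('a, 'r) ring_scheme \<Rightarrow> ('a, 'b, 'm) poisson_alg_scheme \<Rightarrow> 'b set \<Rightarrow> 'b set \<Rightarrow> 'b set"
  where "span_bracket R A U W =
    LinearCombinations.module.span R A {\<lbrace>u, w\<rbrace>\<^bsub>A\<^esub> |u w. u \<in> U \<and> w \<in> W}"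

primrec subspace_power ::
    "('a, 'r) ring_scheme \<Rightarrow> ('a, 'b, 'm) module_scheme \<Rightarrow> 'b set \<Rightarrow> nat \<Rightarrow> 'b set"
  where
    "subspace_power R A V 0 = LinearCombinations.module.span R A {\<one>\<^bsub>A\<^esub>}"
  | "subspace_power R A V (Suc n) = span_mult R A V (subspace_power R A V n)"

primrec poisson_power ::
    "('a, 'r) ring_scheme \<Rightarrow> ('a, 'b, 'm) poisson_alg_scheme \<Rightarrow> 'b set \<Rightarrow> nat \<Rightarrow> 'b set"
  where
    "poisson_power R A V 0 = LinearCombinations.module.span R A {\<one>\<^bsub>A\<^esub>}"
  | "poisson_power R A V (Suc n) = LinearCombinations.module.submodule_sum A
      (span_mult R A V (poisson_power R A V n)) (span_bracket R A V (poisson_power R A V n))"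

text \<open>
  A finite sum of subspaces is written as the span of their union. Since \<^term>\<open>ln (0::real) = 0\<close>,
  the zero algebra gets \<open>GKdim\<close> and \<open>PGKdim\<close> equal to 0; the junk values of \<^const>\<open>log\<close> at bases
  0 and 1 do not affect the limes superior.
\<close>

definition growth_exponent :: "(nat \<Rightarrow> nat) \<Rightarrow> ereal"
  where "growth_exponent d = limsup (\<lambda>n. ereal (log (real n) (real (d n))))"

definition GKdim :: "('a, 'r) ring_scheme \<Rightarrow> ('a, 'b, 'm) module_scheme \<Rightarrow> ereal"
  where "GKdim R A = (SUP V\<in>{V. fin_dim_subspace R V A}. growth_exponent (\<lambda>n.
    subspace_dim R A (LinearCombinations.module.span R A (\<Union>k\<le>n. subspace_power R A V k))))"

definition pd ::
    "('a, 'r) ring_scheme \<Rightarrow> ('a, 'b, 'm) poisson_alg_scheme \<Rightarrow> 'b set \<Rightarrow> nat \<Rightarrow> nat"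
  where "pd R A V n =
    subspace_dim R A (LinearCombinations.module.span R A (\<Union>k\<le>n. poisson_power R A V k))"

definition poisson_subalgebra ::
    "('a, 'r) ring_scheme \<Rightarrow> 'b set \<Rightarrow> ('a, 'b, 'm) poisson_alg_scheme \<Rightarrow> bool"
  where "poisson_subalgebra R B A \<longleftrightarrow> VectorSpace.subspace R B A \<and> \<one>\<^bsub>A\<^esub> \<in> B \<and>
    (\<forall>x\<in>B. \<forall>y\<in>B. x \<otimes>\<^bsub>A\<^esub> y \<in> B \<and> \<lbrace>x, y\<rbrace>\<^bsub>A\<^esub> \<in> B)"

definition poisson_generates ::
    "('a, 'r) ring_scheme \<Rightarrow> ('a, 'b, 'm) poisson_alg_scheme \<Rightarrow> 'b set \<Rightarrow> bool"
  where "poisson_generates R A V \<longleftrightarrow>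
    \<Inter>{B. poisson_subalgebra R B A \<and> V \<subseteq> B} = carrier A"

definition poisson_fin_gen ::
    "('a, 'r) ring_scheme \<Rightarrow> ('a, 'b, 'm) poisson_alg_scheme \<Rightarrow> bool"
  where "poisson_fin_gen R A \<longleftrightarrow> (\<exists>V. fin_dim_subspace R V A \<and> poisson_generates R A V)"

text \<open>
  For a finitely generated Poisson algebra the value \<open>limsup log\<^sub>n pd\<^sub>V(n)\<close> is the same for all
  finite-dimensional generating subspaces \<open>V\<close>; the supremum below is this common value.
\<close>

definition PGKdim_fg :: "('a, 'r) ring_scheme \<Rightarrow> ('a, 'b, 'm) poisson_alg_scheme \<Rightarrow> ereal"
  where "PGKdim_fg R A =
    (SUP V\<in>{V. fin_dim_subspace R V A \<and> poisson_generates R A V}. growth_exponent (pd R A V))"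

definition PGKdim :: "('a, 'r) ring_scheme \<Rightarrow> ('a, 'b, 'm) poisson_alg_scheme \<Rightarrow> ereal"
  where "PGKdim R A =
    (SUP B\<in>{B. poisson_subalgebra R B A \<and> poisson_fin_gen R (A\<lparr>carrier := B\<rparr>)}.
      PGKdim_fg R (A\<lparr>carrier := B\<rparr>))"

text \<open>
  The polynomial ring in countably many variables, as finitely supported functions from
  monomials to coefficients. The variable with index \<open>i\<close> stands for \<open>x\<^sub>i\<^sub>+\<^sub>1\<close>, so that
  the variables \<open>x\<^sub>1, x\<^sub>2, \<dots>\<close> use up all of \<^typ>\<open>nat\<close>; see \<open>xvar\<close>.
\<close>

type_synonym 'k infpoly = "(nat \<Rightarrow>\<^sub>0 nat) \<Rightarrow>\<^sub>0 'k"

definition var :: "nat \<Rightarrow> 'k::comm_ring_1 infpoly"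
  where "var i = Poly_Mapping.single (Poly_Mapping.single i 1) 1"

abbreviation xvar :: "nat \<Rightarrow> 'k::comm_ring_1 infpoly"
  where "xvar n \<equiv> var (n - 1)"

definition indets :: "'k::zero infpoly \<Rightarrow> nat set"
  where "indets f = (\<Union>m\<in>Poly_Mapping.keys f. Poly_Mapping.keys m)"

definition pdiff :: "nat \<Rightarrow> 'k::comm_ring_1 infpoly \<Rightarrow> 'k infpoly"
  where "pdiff i f = (\<Sum>m\<in>Poly_Mapping.keys f.
    Poly_Mapping.single (m - Poly_Mapping.single i 1) (of_nat (Poly_Mapping.lookup m i) * Poly_Mapping.lookup f m))"

text \<open>
  The biderivation with \<open>{x\<^sub>i, x\<^sub>j} = (j - i) x\<^sub>i\<^sub>+\<^sub>j\<close>, i.e.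
  \<open>{f, g} = \<Sum>\<^sub>i\<^sub>,\<^sub>j (\<partial>f/\<partial>x\<^sub>i) (\<partial>g/\<partial>x\<^sub>j) (j - i) x\<^sub>i\<^sub>+\<^sub>j\<close>; the index \<open>i + j + 1\<close> below is due
  to the shift by one.
\<close>

definition witt_bracket :: "'k::comm_ring_1 infpoly \<Rightarrow> 'k infpoly \<Rightarrow> 'k infpoly"
  where "witt_bracket f g = (\<Sum>i\<in>indets f. \<Sum>j\<in>indets g.
    pdiff i f * pdiff j g * of_int (int j - int i) * var (i + j + 1))"

definition SW :: "('k::field_char_0, 'k infpoly) poisson_alg"
  where "SW = \<lparr>carrier = UNIV, mult = (*), one = 1, zero = 0, add = (+),
    smult = (\<lambda>c f. Poly_Mapping.single 0 c * f), pbracket = witt_bracket\<rparr>"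

lemma poly_additive_induct:
  fixes f :: "'k::comm_ring_1 infpoly"
  assumes "\<And>m c. P (Poly_Mapping.single m c)" "\<And>f g. P f \<Longrightarrow> P g \<Longrightarrow> P (f + g)"
  shows "P f"
proof (induction f rule: update_induct)
  case const
  show ?case using assms(1)[of 0 0] by simp
next
  case (update f a b)
  have "Poly_Mapping.update a b f = Poly_Mapping.single a b + f"
    using update(1) by (intro poly_mapping_eqI)
      (auto simp: lookup_update lookup_add lookup_single when_def in_keys_iff)
  thus ?case using assms update by simp
qed

lemma lookup_pdiff:
  "Poly_Mapping.lookup (pdiff i f) m =
    of_nat (Poly_Mapping.lookup m i + 1) * Poly_Mapping.lookup f (m + Poly_Mapping.single i 1)"
proof -
  let ?e = "Poly_Mapping.single i (1::nat)"
  have *: "(of_nat (Poly_Mapping.lookup m' i) * Poly_Mapping.lookup f m' when m' - ?e = m) =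
      (if m' = m + ?e then of_nat (Poly_Mapping.lookup m' i) * Poly_Mapping.lookup f m' else 0)" for m'
  proof (cases "Poly_Mapping.lookup m' i = 0")
    case True
    hence "m' \<noteq> m + ?e" by (auto simp: lookup_add)
    thus ?thesis using True by simp
  next
    case False
    have "m' - ?e = m \<longleftrightarrow> m' = m + ?e"
    proof
      assume "m' - ?e = m"
      thus "m' = m + ?e" using False
        by (intro poly_mapping_eqI) (auto simp: lookup_add lookup_minus lookup_single when_def)
    qed simp
    thus ?thesis by (simp add: when_def)
  qed
  have "Poly_Mapping.lookup (pdiff i f) m = (\<Sum>m'\<in>Poly_Mapping.keys f. if m' = m + ?e then of_nat (Poly_Mapping.lookup m' i) * Poly_Mapping.lookup f m' else 0)"
    unfolding pdiff_def lookup_sum lookup_single * ..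
  also have "\<dots> = (if m + ?e \<in> Poly_Mapping.keys f then of_nat (Poly_Mapping.lookup (m + ?e) i) * Poly_Mapping.lookup f (m + ?e) else 0)"
    by (simp add: sum.delta)
  also have "\<dots> = of_nat (Poly_Mapping.lookup m i + 1) * Poly_Mapping.lookup f (m + ?e)"
    by (auto simp: in_keys_iff lookup_add)
  finally show ?thesis .
qed

lemma pdiff_add: "pdiff i (f + g) = pdiff i f + pdiff i g"
  by (rule poly_mapping_eqI) (simp add: lookup_pdiff lookup_add distrib_left)

lemma pdiff_single:
  "pdiff i (Poly_Mapping.single m c) =
    Poly_Mapping.single (m - Poly_Mapping.single i 1) (of_nat (Poly_Mapping.lookup m i) * c)"
  by (cases "c = 0") (simp_all add: pdiff_def)

lemma pdiff_eq_0: "i \<notin> indets f \<Longrightarrow> pdiff i f = 0"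
  unfolding pdiff_def indets_def by (intro sum.neutral ballI) (auto simp: in_keys_iff)

lemma finite_indets: "finite (indets f)"
  by (simp add: indets_def)

lemma pdiff_var: "pdiff i (var j) = (if i = j then 1 else 0)"
  by (simp add: var_def pdiff_single lookup_single when_def)

lemma pdiff_mult: "pdiff i (f * g) = f * pdiff i g + g * pdiff i f"
proof (induction f rule: poly_additive_induct)
  case (1 m c)
  show ?case
  proof (induction g rule: poly_additive_induct)
    case (1 n d)
    let ?e = "Poly_Mapping.single i (Suc 0)"
    have 1: "m + (n - ?e) = m + n - ?e" if "Poly_Mapping.lookup n i > 0"
      using that by (intro poly_mapping_eqI) (auto simp: lookup_add lookup_minus lookup_single when_def)
    have 2: "n + (m - ?e) = m + n - ?e" if "Poly_Mapping.lookup m i > 0"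
      using that by (intro poly_mapping_eqI) (auto simp: lookup_add lookup_minus lookup_single when_def)
    show ?case
      by (cases "Poly_Mapping.lookup m i > 0"; cases "Poly_Mapping.lookup n i > 0")
        (auto simp: mult_single pdiff_single 1 2 lookup_add single_add[symmetric] algebra_simps)
  next
    case (2 f g)
    thus ?case by (simp add: pdiff_add algebra_simps)
  qed
next
  case (2 f g)
  thus ?case by (simp add: pdiff_add algebra_simps)
qed

lemma witt_bracket_alt:
  assumes "finite I" "indets f \<subseteq> I" "finite J" "indets g \<subseteq> J"
  shows "witt_bracket f g = (\<Sum>i\<in>I. \<Sum>j\<in>J.
    pdiff i f * pdiff j g * of_int (int j - int i) * var (i + j + 1))"
proof -
  have "witt_bracket f g = (\<Sum>i\<in>indets f. \<Sum>j\<in>J.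
      pdiff i f * pdiff j g * of_int (int j - int i) * var (i + j + 1))"
    unfolding witt_bracket_def
    by (intro sum.cong refl sum.mono_neutral_left) (use assms in \<open>auto simp: pdiff_eq_0\<close>)
  also have "\<dots> = (\<Sum>i\<in>I. \<Sum>j\<in>J.
      pdiff i f * pdiff j g * of_int (int j - int i) * var (i + j + 1))"
    by (intro sum.mono_neutral_left) (use assms in \<open>auto simp: pdiff_eq_0\<close>)
  finally show ?thesis .
qed

lemma witt_bracket_add: "witt_bracket (f + g) h = witt_bracket f h + witt_bracket g h"
proof -
  let ?I = "indets f \<union> indets g \<union> indets (f + g)"
  have "witt_bracket a h = (\<Sum>i\<in>?I. \<Sum>j\<in>indets h.
      pdiff i a * pdiff j h * of_int (int j - int i) * var (i + j + 1))" if "a \<in> {f, g, f + g}" for a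
    using that by (intro witt_bracket_alt) (auto simp: finite_indets)
  thus ?thesis by (simp add: pdiff_add distrib_right sum.distrib)
qed

lemma witt_bracket_mult: "witt_bracket (f * g) h = f * witt_bracket g h + g * witt_bracket f h"
proof -
  let ?I = "indets f \<union> indets g \<union> indets (f * g)"
  have "witt_bracket a h = (\<Sum>i\<in>?I. \<Sum>j\<in>indets h.
      pdiff i a * pdiff j h * of_int (int j - int i) * var (i + j + 1))" if "a \<in> {f, g, f * g}" for a
    using that by (intro witt_bracket_alt) (auto simp: finite_indets)
  thus ?thesis by (simp add: pdiff_mult distrib_right sum.distrib sum_distrib_left mult.assoc)
qed

lemma witt_bracket_antisym: "witt_bracket f g = - witt_bracket g f"
proof -
  have "witt_bracket f g = (\<Sum>j\<in>indets g. \<Sum>i\<in>indets f.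
      pdiff i f * pdiff j g * of_int (int j - int i) * var (i + j + 1))"
    unfolding witt_bracket_def by (rule sum.swap)
  also have "\<dots> = - witt_bracket g f"
    unfolding witt_bracket_def sum_negf[symmetric]
  proof (intro sum.cong refl)
    fix i j
    have "of_int (int j - int i) = - (of_int (int i - int j) :: 'a infpoly)" by simp
    thus "pdiff i f * pdiff j g * of_int (int j - int i) * var (i + j + 1) =
        - (pdiff j g * pdiff i f * of_int (int i - int j) * var (j + i + 1))"
      by (simp only: add.commute mult.commute mult_minus_left mult_minus_right)
  qed
  finally show ?thesis .
qed

lemma witt_bracket_xvar:
  assumes "i \<ge> 1" "j \<ge> 1"
  shows "witt_bracket (xvar i) (xvar j) = of_int (int j - int i) * (xvar (i + j) :: 'k::comm_ring_1 infpoly)"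
proof -
  have [simp]: "indets (var n :: 'k infpoly) = {n}" for n
    by (simp add: indets_def var_def)
  obtain a b where "i = Suc a" "j = Suc b"
    using assms by (metis Suc_le_D One_nat_def)
  thus ?thesis by (simp add: witt_bracket_def pdiff_var)
qed

lemma infpoly_induct [case_names const var add mult]:
  fixes f :: "'k::comm_ring_1 infpoly"
  assumes "\<And>c. P (Poly_Mapping.single 0 c)" "\<And>i. P (var i)"
    and "\<And>f g. P f \<Longrightarrow> P g \<Longrightarrow> P (f + g)" "\<And>f g. P f \<Longrightarrow> P g \<Longrightarrow> P (f * g)"
  shows "P f"
proof (rule poly_additive_induct[where P = P])
  have pow: "P (Poly_Mapping.single (Poly_Mapping.single i n) 1)" for i n
  proof (induction n)
    case (Suc n)
    have "Poly_Mapping.single (Poly_Mapping.single i (Suc n)) 1 =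
        var i * Poly_Mapping.single (Poly_Mapping.single i n) (1::'k)"
      by (simp add: var_def mult_single single_add[symmetric])
    thus ?case using Suc assms(2,4) by metis
  qed (use assms(1)[of 1] in simp)
  have "P (Poly_Mapping.single m 1)" for m
  proof (induction m rule: update_induct)
    case (update m a b)
    have "Poly_Mapping.update a b m = Poly_Mapping.single a b + m"
      using update(1) by (intro poly_mapping_eqI)
        (auto simp: lookup_update lookup_add lookup_single when_def in_keys_iff)
    hence "Poly_Mapping.single (Poly_Mapping.update a b m) 1 =
        Poly_Mapping.single (Poly_Mapping.single a b) 1 * Poly_Mapping.single m (1::'k)"
      by (simp add: mult_single)
    thus ?case using update pow assms(4) by metis
  qed (use assms(1)[of 1] in simp)
  thus "P (Poly_Mapping.single m c)" for m c
    using assms(4)[OF assms(1)[of c], of "Poly_Mapping.single m 1"] by (simp add: mult_single)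
qed (rule assms(3))

lemma witt_bracket_const: "witt_bracket (Poly_Mapping.single 0 c) g = 0"
  by (simp add: witt_bracket_def indets_def)

lemma witt_bracket_add_right: "witt_bracket f (g + h) = witt_bracket f g + witt_bracket f h"
  using witt_bracket_antisym[of f "g + h"] witt_bracket_antisym[of f g] witt_bracket_antisym[of f h]
  by (simp add: witt_bracket_add)

lemma witt_bracket_mult_right:
  "witt_bracket f (g * h) = g * witt_bracket f h + h * witt_bracket f g"
  using witt_bracket_antisym[of f "g * h"] witt_bracket_antisym[of f g] witt_bracket_antisym[of f h]
  by (simp add: witt_bracket_mult)

lemma witt_bracket_const_right: "witt_bracket f (Poly_Mapping.single 0 c) = 0"
  using witt_bracket_antisym[of f "Poly_Mapping.single 0 c"] by (simp add: witt_bracket_const)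

lemma witt_bracket_jacobi:
  fixes f g h :: "'k::comm_ring_1 infpoly"
  shows "witt_bracket f (witt_bracket g h) + witt_bracket g (witt_bracket h f)
    + witt_bracket h (witt_bracket f g) = 0"
proof -
  let ?B = "witt_bracket :: 'k infpoly \<Rightarrow> _"
  define J where "J f g h = ?B f (?B g h) + ?B g (?B h f) + ?B h (?B f g)" for f g h
  note add_r = witt_bracket_add_right and mult_r = witt_bracket_mult_right
    and const_r = witt_bracket_const_right
  have zero_r: "?B a 0 = 0" for a using const_r[of a 0] by simp
  have minus_r: "?B a (- b) = - ?B a b" for a b
    using add_r[of a b "- b"] by (simp add: zero_r eq_neg_iff_add_eq_0 add.commute)
  have cyc: "J f g h = J g h f" for f g h by (simp add: J_def add_ac)
  have J_add: "J (a + b) g h = J a g h + J b g h" for a b g h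
    by (simp add: J_def witt_bracket_add add_r algebra_simps)
  have J_mult: "J (a * b) g h = a * J b g h + b * J a g h" for a b g h
  proof -
    have s: "?B b g = - ?B g b" "?B a g = - ?B g a" "?B b h = - ?B h b" "?B a h = - ?B h a"
      by (rule witt_bracket_antisym)+
    show ?thesis
      unfolding J_def witt_bracket_mult mult_r add_r s minus_r by (simp add: algebra_simps)
  qed
  have J_const: "J (Poly_Mapping.single 0 c) g h = 0" for c g h
    by (simp add: J_def witt_bracket_const const_r zero_r)
  have Jv: "J (var i) (var j) (var k) = 0" for i j k
  proof -
    have b: "?B (var i) (var j) = of_int (int j - int i) * var (i + j + 1)" for i j
      using witt_bracket_xvar[of "i + 1" "j + 1", where ?'k = 'k] by simp
    have ci: "?B a (of_int z * b) = of_int z * ?B a b" for a b z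
    proof -
      have "(of_int z :: 'k infpoly) = Poly_Mapping.single 0 (of_int z)"
        by (rule poly_mapping_eqI) (simp add: lookup_of_int lookup_single)
      hence "?B a (of_int z) = 0" by (simp only: const_r)
      thus ?thesis by (simp add: mult_r)
    qed
    show ?thesis
      unfolding J_def b ci by (simp add: algebra_simps)
  qed
  have "J f (var j) (var k) = 0" for f j k
    by (induction f rule: infpoly_induct) (simp_all add: J_add J_mult J_const Jv)
  hence "J (var j) (var k) f = 0" for f j k by (metis cyc)
  hence "J f g (var j) = 0" if "g = var k" for f g j k using that by (metis cyc)
  hence "J g (var j) f = 0" for f g j
    by (induction g rule: infpoly_induct) (simp_all add: J_add J_mult J_const, metis cyc)
  hence "J (var j) f g = 0" for f g j by (metis cyc)
  hence "J f g h = 0" for f g h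
    by (induction f rule: infpoly_induct) (simp_all add: J_add J_mult J_const)
  thus ?thesis by (simp add: J_def)
qed

lemma poisson_algebra_SW:
  "poisson_algebra class_ring (SW :: ('k::field_char_0, 'k infpoly) poisson_alg)"
proof -
  let ?A = "SW :: ('k, 'k infpoly) poisson_alg"
  have ring: "cring ?A"
    by (intro cringI abelian_groupI comm_monoidI)
      (auto simp: SW_def algebra_simps intro: exI[of _ "- _"])
  have alg: "algebra class_ring ?A"
    by (intro algebraI ring class_cring.cring_axioms)
      (auto simp: SW_def algebra_simps single_add mult_single[of 0 _ 0, symmetric, simplified])
  have neg: "\<ominus>\<^bsub>?A\<^esub> f = - f" for f
    using abelian_group.minus_equality[OF cring.axioms(1)[THEN ring.is_abelian_group, OF ring], of "- f" f]
    by (simp add: SW_def)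
  show ?thesis
  proof (intro poisson_algebra.intro poisson_algebra_axioms.intro alg, goal_cases)
    case (4 f g)
    show ?case unfolding neg by (simp add: SW_def witt_bracket_antisym[of f g])
  qed (simp_all add: SW_def witt_bracket_add witt_bracket_mult witt_bracket_const
        witt_bracket_jacobi)
qed

end

theory Submission
  imports Defs
begin

text \<open>
  Let \<open>f\<close> be a nonzero element of \<open>K\<close>, \<open>x\<^sub>r\<close> its last variable and \<open>g = \<partial>f/\<partial>x\<^sub>r\<close>. The relations
  \<open>{f, x\<^sub>n} \<in> K\<close> express \<open>g x\<^sub>r\<^sub>+\<^sub>n\<close> by earlier variables, so that \<open>g\<^sup>n\<close> carries every polynomial of
  weight at most \<open>n\<close> into the polynomials of degree \<open>O(n)\<close> in a fixed finite set of variables, modulo \<open>K\<close>.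
  If \<open>g\<close> is a nonzerodivisor modulo \<open>K\<close>, the image of the former space in the quotient is therefore no
  larger than that of the latter. In general \<open>K\<close> is the intersection of \<open>K\<^sub>1 = (K : g)\<close> and
  \<open>K\<^sub>2 = (K : K\<^sub>1)\<close>; both are radical Poisson ideals, \<open>g\<close> is a nonzerodivisor modulo \<open>K\<^sub>1\<close>, and \<open>K\<^sub>2\<close>
  contains the element \<open>g\<close>, whose degree is smaller than that of \<open>f\<close>. Induction on the degree thus bounds
  the dimension of the polynomials of weight at most \<open>n\<close> modulo \<open>K\<close>, up to constants, by that of the
  polynomials of degree at most \<open>n\<close> in finitely many variables \<open>x\<^sub>1, \<dots>, x\<^sub>M\<close>. Since products and brackets
  both add weights, either growth function of any finite-dimensional subspace is dominated by the growth of
  the span \<open>W\<close> of \<open>1, x\<^sub>1, \<dots>, x\<^sub>M\<close>, which is polynomial; and \<open>W\<close> generates the quotient as a Poisson algebra.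
\<close>

section \<open>Linear independence modulo a subspace\<close>

text \<open>Scalars act as constant polynomials, as in \<open>smult SW\<close>, so linear
  combinations are handled by ring identities.\<close>

abbreviation cst :: "'k::comm_ring_1 \<Rightarrow> 'k infpoly"
  where "cst c \<equiv> Poly_Mapping.single 0 c"

lemma cst_mult: "cst (a * b) = cst a * cst b"
  by (simp add: mult_single)

lemma cst_sum: "cst (sum f A) = (\<Sum>x\<in>A. cst (f x))"
  by (induction A rule: infinite_finite_induct) (simp_all add: single_add)

definition subspace_poly :: "'k::comm_ring_1 infpoly set \<Rightarrow> bool"
  where "subspace_poly U \<longleftrightarrow> 0 \<in> U \<and> (\<forall>f\<in>U. \<forall>g\<in>U. f + g \<in> U) \<and> (\<forall>c. \<forall>f\<in>U. cst c * f \<in> U)"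

lemma subspace_polyD:
  assumes "subspace_poly U"
  shows "0 \<in> U" "f \<in> U \<Longrightarrow> g \<in> U \<Longrightarrow> f + g \<in> U" "f \<in> U \<Longrightarrow> cst c * f \<in> U"
  using assms by (auto simp: subspace_poly_def)

lemma subspace_poly_sum:
  assumes "subspace_poly U" "\<And>i. i \<in> I \<Longrightarrow> f i \<in> U"
  shows "sum f I \<in> U"
  using assms(2) by (induction I rule: infinite_finite_induct) (auto intro: subspace_polyD[OF assms(1)])

lemma subspace_poly_uminus:
  assumes "subspace_poly U" "f \<in> U"
  shows "- f \<in> U"
  using subspace_polyD(3)[OF assms, of "- 1"] by (simp add: single_uminus)

lemma subspace_poly_diff:
  assumes "subspace_poly U" "f \<in> U" "g \<in> U"
  shows "f - g \<in> U"
  using subspace_polyD(2)[OF assms(1,2) subspace_poly_uminus[OF assms(1,3)]] by simp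

text \<open>
  Independence is stated for families, since the elements produced by a choice modulo \<open>K\<close> are not
  known to be distinct beforehand; for a set the family is the identity.
\<close>

definition indep_mod :: "'k::field infpoly set \<Rightarrow> 'i set \<Rightarrow> ('i \<Rightarrow> 'k infpoly) \<Rightarrow> bool"
  where "indep_mod K I e \<longleftrightarrow> finite I \<and>
    (\<forall>c. (\<Sum>i\<in>I. cst (c i) * e i) \<in> K \<longrightarrow> (\<forall>i\<in>I. c i = 0))"

lemma indep_modD:
  assumes "indep_mod K I e" "(\<Sum>i\<in>I. cst (c i) * e i) \<in> K" "i \<in> I"
  shows "c i = 0"
  using assms by (auto simp: indep_mod_def)

lemma indep_mod_antimono: "indep_mod K' I e \<Longrightarrow> K \<subseteq> K' \<Longrightarrow> indep_mod K I e"
  by (auto simp: indep_mod_def)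

text \<open>Equal values at distinct indices would yield the nontrivial relation
  \<open>e i - e j = 0\<close>. A family of chosen representatives may therefore be replaced by the
  set of its values.\<close>

lemma indep_mod_image:
  fixes K :: "'k::field infpoly set"
  assumes "subspace_poly K" "indep_mod K I e"
  shows "inj_on e I" and "indep_mod K (e ` I) (\<lambda>x. x)"
proof -
  have fin: "finite I" using assms by (simp add: indep_mod_def)
  show inj: "inj_on e I"
  proof (rule inj_onI, rule ccontr)
    fix i j assume ij: "i \<in> I" "j \<in> I" "e i = e j" "i \<noteq> j"
    let ?c = "\<lambda>l. (if l = i then 1 else 0) - (if l = j then 1 else 0) :: 'k"
    have "(\<Sum>l\<in>I. cst (?c l) * e l) =
        (\<Sum>l\<in>I. (if l = i then e l else 0) - (if l = j then e l else 0))"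
      by (intro sum.cong refl) (auto simp: single_diff)
    also have "\<dots> = 0" using fin ij by (simp add: sum_subtractf sum.delta)
    finally have "?c i = 0"
      using indep_modD[OF assms(2), of ?c i] ij subspace_polyD(1)[OF assms(1)] by simp
    thus False using ij(4) by simp
  qed
  show "indep_mod K (e ` I) (\<lambda>x. x)"
    unfolding indep_mod_def
  proof (intro conjI allI impI ballI)
    fix c x assume "(\<Sum>x\<in>e ` I. cst (c x) * x) \<in> K" "x \<in> e ` I"
    moreover have "(\<Sum>x\<in>e ` I. cst (c x) * x) = (\<Sum>i\<in>I. cst (c (e i)) * e i)"
      by (simp add: sum.reindex[OF inj])
    ultimately have "(\<Sum>i\<in>I. cst (c (e i)) * e i) \<in> K" "x \<in> e ` I" by simp_all
    thus "c x = 0" using indep_modD[OF assms(2)] by (metis imageE)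
  qed (use fin in simp)
qed

text \<open>
  A maximal subset \<open>C\<close> of \<open>B\<close> that is independent modulo \<open>K1\<close> allows one to correct the elements of
  \<open>B - C\<close> by combinations of \<open>C\<close> so that they lie in \<open>K1\<close>; a relation modulo \<open>K2\<close> among the corrected
  elements is then one modulo \<open>K1 \<inter> K2\<close>.
\<close>

lemma indep_mod_Int:
  assumes K: "subspace_poly K1" "subspace_poly K2" and U: "subspace_poly U"
    and B: "B \<subseteq> U" "indep_mod (K1 \<inter> K2) B (\<lambda>x. x)"
  obtains C D where "C \<subseteq> U" "D \<subseteq> U" "indep_mod K1 C (\<lambda>x. x)" "indep_mod K2 D (\<lambda>x. x)"
    "card B = card C + card D"
proof -
  have fin: "finite B" using B(2) by (simp add: indep_mod_def)
  have "\<exists>C\<subseteq>B. indep_mod K1 C (\<lambda>x. x) \<and>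
      (\<forall>C'. C' \<subseteq> B \<and> indep_mod K1 C' (\<lambda>x. x) \<longrightarrow> card C' \<le> card C)"
  proof -
    let ?P = "\<lambda>C. C \<subseteq> B \<and> indep_mod K1 C (\<lambda>x. x)"
    have "\<exists>C. ?P C \<and> (\<forall>C'. ?P C' \<longrightarrow> card C' \<le> card C)"
      by (rule ex_has_greatest_nat[of ?P "{}" card "Suc (card B)"])
        (use card_mono[OF fin] in \<open>auto simp: indep_mod_def less_Suc_eq_le\<close>)
    thus ?thesis by blast
  qed
  then obtain C where C: "C \<subseteq> B" "indep_mod K1 C (\<lambda>x. x)"
      and max: "\<And>C'. C' \<subseteq> B \<Longrightarrow> indep_mod K1 C' (\<lambda>x. x) \<Longrightarrow> card C' \<le> card C"
    by blast
  have finC: "finite C" using C fin finite_subset by blast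
  have ex: "\<exists>a. b + (\<Sum>x\<in>C. cst (a x) * x) \<in> K1" if b: "b \<in> B - C" for b
  proof -
    have "\<not> indep_mod K1 (insert b C) (\<lambda>x. x)"
      using max[of "insert b C"] b C(1) finC by auto
    then obtain c x where c: "(\<Sum>x\<in>insert b C. cst (c x) * x) \<in> K1" "x \<in> insert b C" "c x \<noteq> 0"
      using finC by (auto simp: indep_mod_def)
    have eq: "(\<Sum>x\<in>insert b C. cst (c x) * x) = cst (c b) * b + (\<Sum>x\<in>C. cst (c x) * x)"
      using b finC by simp
    \<comment> \<open>If \<open>c b\<close> were 0, the relation would live on the independent set
      \<open>C\<close>; hence \<open>b\<close> can be solved for modulo \<open>K1\<close>.\<close>
    have cb: "c b \<noteq> 0"
      using c indep_modD[OF C(2), of c x] by (auto simp: eq)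
    have "cst (inverse (c b)) * (cst (c b) * b + (\<Sum>x\<in>C. cst (c x) * x)) =
        b + (\<Sum>x\<in>C. cst (inverse (c b) * c x) * x)"
      unfolding distrib_left sum_distrib_left mult.assoc[symmetric] cst_mult[symmetric]
      using cb by simp
    hence "b + (\<Sum>x\<in>C. cst (inverse (c b) * c x) * x) \<in> K1"
      using subspace_polyD(3)[OF K(1) c(1), of "inverse (c b)"] by (simp only: eq)
    thus ?thesis by (rule exI[of _ "\<lambda>x. inverse (c b) * c x"])
  qed
  define a where "a b = (SOME a. b + (\<Sum>x\<in>C. cst (a x) * x) \<in> K1)" for b
  have a: "b + (\<Sum>x\<in>C. cst (a b x) * x) \<in> K1" if "b \<in> B - C" for b
    using someI_ex[OF ex[OF that]] by (simp add: a_def)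
  define e where "e b = b + (\<Sum>x\<in>C. cst (a b x) * x)" for b
  have ind: "indep_mod K2 (B - C) e"
    unfolding indep_mod_def
  proof (intro conjI allI impI ballI)
    fix c b assume *: "(\<Sum>b\<in>B - C. cst (c b) * e b) \<in> K2" and b: "b \<in> B - C"
    \<comment> \<open>The relation rewritten in terms of \<open>B\<close>: coefficients outside
      \<open>C\<close> are unchanged, those on \<open>C\<close> collect the corrections.\<close>
    let ?c = "\<lambda>x. if x \<in> C then \<Sum>b\<in>B - C. c b * a b x else c x"
    have "(\<Sum>b\<in>B - C. cst (c b) * e b) =
        (\<Sum>b\<in>B - C. cst (c b) * b) + (\<Sum>b\<in>B - C. \<Sum>x\<in>C. cst (c b * a b x) * x)"
      by (simp add: e_def distrib_left sum.distrib sum_distrib_left cst_mult mult.assoc)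
    also have "(\<Sum>b\<in>B - C. \<Sum>x\<in>C. cst (c b * a b x) * x) =
        (\<Sum>x\<in>C. cst (\<Sum>b\<in>B - C. c b * a b x) * x)"
      by (subst sum.swap) (simp add: cst_sum sum_distrib_right)
    also have "(\<Sum>b\<in>B - C. cst (c b) * b) + \<dots> = (\<Sum>x\<in>B. cst (?c x) * x)"
      by (simp add: sum.subset_diff[OF C(1) fin])
    finally have eq: "(\<Sum>b\<in>B - C. cst (c b) * e b) = (\<Sum>x\<in>B. cst (?c x) * x)" .
    have "(\<Sum>b\<in>B - C. cst (c b) * e b) \<in> K1"
      by (intro subspace_poly_sum[OF K(1)] subspace_polyD(3)[OF K(1)]) (auto simp: e_def a)
    with * have "(\<Sum>x\<in>B. cst (?c x) * x) \<in> K1 \<inter> K2" by (simp add: eq)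
    from indep_modD[OF B(2) this, of b] b show "c b = 0" by auto
  qed (use fin in auto)
  have "e ` (B - C) \<subseteq> U"
    using B(1) C(1) by (auto simp: e_def intro!: subspace_polyD[OF U] subspace_poly_sum[OF U])
  moreover have "card B = card C + card (e ` (B - C))"
    using card_image[OF indep_mod_image(1)[OF K(2) ind]] C(1) fin
    by (simp add: card_Diff_subset finC card_mono)
  ultimately show thesis
    using that[of C "e ` (B - C)"] C B(1) indep_mod_image(2)[OF K(2) ind] by blast
qed

section \<open>Weights and degrees\<close>

text \<open>One function serves two gradings: \<open>wdeg Suc\<close> is the weight in which
  \<open>e_i\<close> has weight \<open>i\<close>, and \<open>wdeg (\<lambda>_. 1)\<close> is the
  total degree.\<close>

definition wdeg :: "(nat \<Rightarrow> nat) \<Rightarrow> (nat \<Rightarrow>\<^sub>0 nat) \<Rightarrow> nat"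
  where "wdeg u m = (\<Sum>i\<in>Poly_Mapping.keys m. u i * Poly_Mapping.lookup m i)"

lemma wdeg_superset:
  assumes "finite A" "Poly_Mapping.keys m \<subseteq> A"
  shows "wdeg u m = (\<Sum>i\<in>A. u i * Poly_Mapping.lookup m i)"
  unfolding wdeg_def by (intro sum.mono_neutral_left) (use assms in \<open>auto simp: in_keys_iff\<close>)

lemma wdeg_add: "wdeg u (m + m') = wdeg u m + wdeg u m'"
proof -
  let ?A = "Poly_Mapping.keys m \<union> Poly_Mapping.keys m'"
  have "wdeg u a = (\<Sum>i\<in>?A. u i * Poly_Mapping.lookup a i)" if "a \<in> {m, m', m + m'}" for a
    by (rule wdeg_superset) (use that Poly_Mapping.keys_add[of m m'] in auto)
  thus ?thesis by (simp add: lookup_add distrib_left sum.distrib)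
qed

lemma wdeg_single: "wdeg u (Poly_Mapping.single i k) = u i * k"
  by (simp add: wdeg_def)

lemma wdeg_zero: "wdeg u 0 = 0"
  by (simp add: wdeg_def)

lemma wdeg_ge:
  assumes "i \<in> Poly_Mapping.keys m"
  shows "u i \<le> wdeg u m"
proof -
  have "u i \<le> u i * Poly_Mapping.lookup m i"
    using assms by (simp add: in_keys_iff)
  also have "\<dots> \<le> wdeg u m"
    unfolding wdeg_def by (rule member_le_sum) (use assms in auto)
  finally show ?thesis .
qed

definition polys_on :: "(nat \<Rightarrow>\<^sub>0 nat) set \<Rightarrow> 'k::comm_ring_1 infpoly set"
  where "polys_on T = {f. Poly_Mapping.keys f \<subseteq> T}"

lemma keys_cst_mult: "Poly_Mapping.keys (cst c * f) \<subseteq> Poly_Mapping.keys f"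
  using keys_mult[of "cst c" f] by (auto split: if_splits)

lemma subspace_polys_on: "subspace_poly (polys_on T)"
  unfolding subspace_poly_def polys_on_def
  by (auto dest!: set_mp[OF keys_cst_mult] set_mp[OF Poly_Mapping.keys_add])

lemma polys_on_mult:
  assumes "f \<in> polys_on S" "g \<in> polys_on T" "\<And>m m'. m \<in> S \<Longrightarrow> m' \<in> T \<Longrightarrow> m + m' \<in> R"
  shows "f * g \<in> polys_on R"
  using assms by (auto simp: polys_on_def dest!: set_mp[OF keys_mult])

lemma polys_on_mono: "S \<subseteq> T \<Longrightarrow> polys_on S \<subseteq> polys_on T"
  by (auto simp: polys_on_def)

text \<open>
  The variable \<open>var i\<close> is \<open>x\<^sub>i\<^sub>+\<^sub>1\<close> and hence has weight \<open>Suc i\<close>, which makes the bracket homogeneous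
  of degree 0.
\<close>

definition wle :: "nat \<Rightarrow> 'k::comm_ring_1 infpoly set"
  where "wle n = polys_on {m. wdeg Suc m \<le> n}"

text \<open>In \<open>wle n\<close> the number of available variables grows with \<open>n\<close>. A
  box fixes the variables, so its dimension is polynomial in \<open>D\<close>.\<close>

definition box :: "nat \<Rightarrow> nat \<Rightarrow> 'k::comm_ring_1 infpoly set"
  where "box M D = polys_on {m. Poly_Mapping.keys m \<subseteq> {..<M} \<and> wdeg (\<lambda>_. 1) m \<le> D}"

lemma subspace_wle: "subspace_poly (wle n)"
  and subspace_box: "subspace_poly (box M D)"
  by (simp_all add: wle_def box_def subspace_polys_on)

lemma wle_mono: "a \<le> b \<Longrightarrow> wle a \<subseteq> wle b"
  unfolding wle_def by (rule polys_on_mono) auto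

lemma box_mono: "M \<le> M' \<Longrightarrow> D \<le> D' \<Longrightarrow> box M D \<subseteq> box M' D'"
  unfolding box_def by (rule polys_on_mono) auto

lemma wle_mult: "f \<in> wle a \<Longrightarrow> g \<in> wle b \<Longrightarrow> f * g \<in> wle (a + b)"
  unfolding wle_def by (rule polys_on_mult) (auto simp: wdeg_add)

lemma box_mult: "f \<in> box M a \<Longrightarrow> g \<in> box M b \<Longrightarrow> f * g \<in> box M (a + b)"
  unfolding box_def
  by (rule polys_on_mult) (auto simp: wdeg_add dest!: set_mp[OF Poly_Mapping.keys_add])

lemma cst_box: "cst c \<in> box M D"
  by (simp add: box_def polys_on_def wdeg_zero)

lemma cst_wle: "cst c \<in> wle n"
  by (simp add: wle_def polys_on_def wdeg_zero)

lemma one_box: "1 \<in> box M D"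
  using cst_box[of 1] by simp

lemma var_box: "i < M \<Longrightarrow> D \<ge> 1 \<Longrightarrow> var i \<in> box M D"
  by (simp add: var_def box_def polys_on_def wdeg_single)

lemma var_wle: "i < n \<Longrightarrow> var i \<in> wle n"
  by (simp add: var_def wle_def polys_on_def wdeg_single)

lemma box_power: "f \<in> box M a \<Longrightarrow> f ^ n \<in> box M (a * n)"
  by (induction n) (auto simp: one_box dest: box_mult)

text \<open>Every variable has weight at least 1, and \<open>var i\<close> has weight above
  \<open>n\<close> once \<open>i \<ge> n\<close>. The crude inclusion serves to guarantee finite
  dimension.\<close>

lemma wle_subset_box: "wle n \<subseteq> box n n"
  unfolding wle_def box_def
proof (rule polys_on_mono, rule subsetI, unfold mem_Collect_eq, intro conjI subsetI)
  fix m :: "nat \<Rightarrow>\<^sub>0 nat" and i assume m: "wdeg Suc m \<le> n" and "i \<in> Poly_Mapping.keys m"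
  thus "i \<in> {..<n}" using wdeg_ge[of i m Suc] m by simp
next
  fix m :: "nat \<Rightarrow>\<^sub>0 nat" assume m: "wdeg Suc m \<le> n"
  have "wdeg (\<lambda>_. 1) m \<le> wdeg Suc m"
    unfolding wdeg_def by (rule sum_mono) simp
  with m show "wdeg (\<lambda>_. 1) m \<le> n" by simp
qed

section \<open>Derivatives and brackets with respect to weight and degree\<close>

lemma keys_pdiff:
  assumes "m \<in> Poly_Mapping.keys (pdiff i f)"
  shows "m + Poly_Mapping.single i 1 \<in> Poly_Mapping.keys f"
  using assms by (auto simp: in_keys_iff lookup_pdiff)

lemma pdiff_box:
  assumes "f \<in> box M D"
  shows "pdiff i f \<in> box M (D - 1)"
  unfolding box_def polys_on_def
proof (unfold mem_Collect_eq, intro subsetI CollectI conjI)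
  fix m j assume "m \<in> Poly_Mapping.keys (pdiff i f)" and j: "j \<in> Poly_Mapping.keys m"
  hence "Poly_Mapping.keys (m + Poly_Mapping.single i 1) \<subseteq> {..<M}"
    using keys_pdiff[of m i f] assms by (auto simp: box_def polys_on_def)
  moreover have "j \<in> Poly_Mapping.keys (m + Poly_Mapping.single i 1)"
    using j by (simp add: in_keys_iff lookup_add)
  ultimately show "j \<in> {..<M}" by blast
next
  fix m assume "m \<in> Poly_Mapping.keys (pdiff i f)"
  hence "wdeg (\<lambda>_. 1) (m + Poly_Mapping.single i 1) \<le> D"
    using keys_pdiff[of m i f] assms by (auto simp: box_def polys_on_def)
  thus "wdeg (\<lambda>_. 1) m \<le> D - 1" by (simp add: wdeg_add wdeg_single)
qed

text \<open>If \<open>Suc i > n\<close>, the variable \<open>var i\<close> cannot occur and the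
  derivative is 0, so the truncated subtraction does no harm.\<close>

lemma pdiff_wle:
  assumes "f \<in> wle n"
  shows "pdiff i f \<in> wle (n - Suc i)"
  unfolding wle_def polys_on_def
proof safe
  fix m assume "m \<in> Poly_Mapping.keys (pdiff i f)"
  hence "wdeg Suc (m + Poly_Mapping.single i 1) \<le> n"
    using keys_pdiff[of m i f] assms by (auto simp: wle_def polys_on_def)
  thus "wdeg Suc m \<le> n - Suc i" by (simp add: wdeg_add wdeg_single)
qed

lemma indets_wle:
  assumes "f \<in> wle n" "i \<in> indets f"
  shows "Suc i \<le> n"
proof -
  obtain m where "m \<in> Poly_Mapping.keys f" "i \<in> Poly_Mapping.keys m"
    using assms(2) by (auto simp: indets_def)
  thus ?thesis using assms(1) wdeg_ge[of i m Suc] by (auto simp: wle_def polys_on_def)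
qed

lemma of_int_eq_cst: "(of_int z :: 'k::comm_ring_1 infpoly) = cst (of_int z)"
  by (rule poly_mapping_eqI) (simp add: lookup_of_int lookup_single)

text \<open>The two derivatives remove the weights \<open>Suc i\<close> and \<open>Suc j\<close>;
  the factor \<open>var (i + j + 1)\<close> restores exactly their sum. For variables that occur,
  the subtractions are not truncated.\<close>

lemma witt_bracket_wle:
  fixes f g :: "'k::comm_ring_1 infpoly"
  assumes "f \<in> wle a" "g \<in> wle b"
  shows "witt_bracket f g \<in> wle (a + b)"
  unfolding witt_bracket_def
proof (intro subspace_poly_sum[OF subspace_wle])
  fix i j assume ij: "i \<in> indets f" "j \<in> indets g"
  have "pdiff i f * pdiff j g * of_int (int j - int i) * var (i + j + 1)
      \<in> wle ((a - Suc i) + (b - Suc j) + 0 + Suc (i + j + 1) :: nat)"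
    unfolding of_int_eq_cst
    by (intro wle_mult pdiff_wle assms cst_wle var_wle) simp
  also have "(a - Suc i) + (b - Suc j) + 0 + Suc (i + j + 1) = a + b"
    using indets_wle[OF assms(1) ij(1)] indets_wle[OF assms(2) ij(2)] by simp
  finally show "pdiff i f * pdiff j g * of_int (int j - int i) * var (i + j + 1) \<in> wle (a + b)" .
qed

lemma witt_bracket_var_right:
  "witt_bracket f (var n) =
    (\<Sum>i\<in>indets f. cst (of_int (int n - int i)) * pdiff i f * var (i + n + 1))"
proof -
  have "indets (var n :: 'a infpoly) = {n}"
    by (simp add: indets_def var_def)
  thus ?thesis
    by (simp add: witt_bracket_def pdiff_var of_int_eq_cst mult_ac)
qed

text \<open>Differentiation multiplies the coefficient of a monomial containing \<open>var i\<close>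
  by its positive exponent, which is nonzero in characteristic zero.\<close>

lemma pdiff_nonzero:
  fixes f :: "'k::field_char_0 infpoly"
  assumes "i \<in> indets f"
  shows "pdiff i f \<noteq> 0"
proof -
  obtain m where m: "m \<in> Poly_Mapping.keys f" "i \<in> Poly_Mapping.keys m"
    using assms by (auto simp: indets_def)
  have eq: "m - Poly_Mapping.single i 1 + Poly_Mapping.single i 1 = m"
    using m(2) by (intro poly_mapping_eqI)
      (auto simp: lookup_add lookup_minus lookup_single when_def in_keys_iff)
  have "of_nat (Poly_Mapping.lookup (m - Poly_Mapping.single i 1) i + 1) \<noteq> (0::'k)"
    unfolding of_nat_eq_0_iff by simp
  hence "Poly_Mapping.lookup (pdiff i f) (m - Poly_Mapping.single i 1) \<noteq> 0"
    using m(1) unfolding lookup_pdiff eq by (simp only: mult_eq_0_iff in_keys_iff) simp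
  thus ?thesis by auto
qed

section \<open>Radical Poisson ideals\<close>

text \<open>Radicality is required for squares only; iterating it yields all powers, and squares are
  what the arguments with colon ideals produce.\<close>

locale poisson_radical =
  fixes K :: "'k::field_char_0 infpoly set"
  assumes zero: "0 \<in> K"
    and add: "f \<in> K \<Longrightarrow> g \<in> K \<Longrightarrow> f + g \<in> K"
    and mult: "f \<in> K \<Longrightarrow> h * f \<in> K"
    and bracket: "f \<in> K \<Longrightarrow> witt_bracket f h \<in> K"
    and square: "f * f \<in> K \<Longrightarrow> f \<in> K"
begin

lemma subspace: "subspace_poly K"
  by (simp add: subspace_poly_def zero add mult)

lemma mult_right: "f \<in> K \<Longrightarrow> f * h \<in> K"
  using mult[of f h] by (simp add: mult.commute)

lemmas diff = subspace_poly_diff[OF subspace]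

lemma colon: "poisson_radical {h. h * g \<in> K}"
proof
  fix f h assume f: "f \<in> {h. h * g \<in> K}"
  \<comment> \<open>Multiplying \<open>{fg, h} = f{g, h} + g{f, h}\<close> by \<open>g{f, h}\<close> leaves \<open>(g{f, h})\<^sup>2\<close> modulo \<open>K\<close>.\<close>
  have "witt_bracket (f * g) h * (g * witt_bracket f h) \<in> K"
    using f by (intro mult_right[OF bracket]) simp
  hence 1: "f * witt_bracket g h * (g * witt_bracket f h)
      + (witt_bracket f h * g) * (witt_bracket f h * g) \<in> K"
    by (simp add: witt_bracket_mult algebra_simps)
  have 2: "f * witt_bracket g h * (g * witt_bracket f h) \<in> K"
    using mult[of "f * g" "witt_bracket g h * witt_bracket f h"] f by (simp add: mult_ac)
  have "(witt_bracket f h * g) * (witt_bracket f h * g) \<in> K"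
    using diff[OF 1 2] by (simp only: add_diff_cancel_left')
  thus "witt_bracket f h \<in> {h. h * g \<in> K}" by (intro CollectI) (rule square)
next
  fix f assume "f * f \<in> {h. h * g \<in> K}"
  hence "(f * g) * (f * g) \<in> K"
    using mult[of "f * f * g" g] by (simp add: mult_ac)
  thus "f \<in> {h. h * g \<in> K}" by (intro CollectI) (rule square)
next
  fix f h assume "f \<in> {h. h * g \<in> K}"
  thus "h * f \<in> {h. h * g \<in> K}" using mult[of "f * g" h] by (simp add: mult_ac)
qed (auto simp: zero add distrib_right)

text \<open>Every condition carries over from the colon ideals of the single elements of
  \<open>S\<close>. Taking \<open>S = K1\<close> gives the second ideal of the
  decomposition.\<close>

lemma colon_set: "poisson_radical {h. \<forall>g\<in>S. h * g \<in> K}"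
proof
  fix f h assume "f \<in> {h. \<forall>g\<in>S. h * g \<in> K}"
  thus "witt_bracket f h \<in> {h. \<forall>g\<in>S. h * g \<in> K}"
    using poisson_radical.bracket[OF colon, of f] by blast
next
  fix f assume "f * f \<in> {h. \<forall>g\<in>S. h * g \<in> K}"
  thus "f \<in> {h. \<forall>g\<in>S. h * g \<in> K}"
    using poisson_radical.square[OF colon, of f] by blast
qed (auto simp: zero add mult distrib_right mult.assoc)

text \<open>This is the sum of \<open>box M D\<close> and \<open>K\<close>; it permits calculations
  modulo \<open>K\<close> with polynomials instead of cosets.\<close>

definition box_mod :: "nat \<Rightarrow> nat \<Rightarrow> 'k infpoly set"
  where "box_mod M D = {h. \<exists>p\<in>box M D. h - p \<in> K}"

lemma box_modI: "p \<in> box M D \<Longrightarrow> h - p \<in> K \<Longrightarrow> h \<in> box_mod M D"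
  by (auto simp: box_mod_def)

lemma box_mod_mono: "D \<le> D' \<Longrightarrow> box_mod M D \<subseteq> box_mod M D'"
  using box_mono[of M M D D'] by (auto simp: box_mod_def)

lemma box_subset_box_mod: "box M D \<subseteq> box_mod M D"
  using zero by (auto intro: box_modI)

lemma subset_box_mod: "K \<subseteq> box_mod M D"
  by (auto intro!: box_modI[of 0] subspace_polyD[OF subspace_box])

lemma box_mod_mult:
  assumes "h \<in> box_mod M D" "h' \<in> box_mod M D'"
  shows "h * h' \<in> box_mod M (D + D')"
proof -
  obtain p p' where p: "p \<in> box M D" "h - p \<in> K" "p' \<in> box M D'" "h' - p' \<in> K"
    using assms by (auto simp: box_mod_def)
  have "h * (h' - p') + p' * (h - p) \<in> K" using p by (intro add mult)
  hence "h * h' - p * p' \<in> K" by (simp add: algebra_simps)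
  thus ?thesis using box_mult[OF p(1,3)] by (rule box_modI[rotated])
qed

lemma subspace_box_mod: "subspace_poly (box_mod M D)"
  unfolding subspace_poly_def
proof (intro conjI ballI allI)
  show "0 \<in> box_mod M D" using subset_box_mod zero by blast
next
  fix h h' assume "h \<in> box_mod M D" "h' \<in> box_mod M D"
  then obtain p p' where p: "p \<in> box M D" "h - p \<in> K" "p' \<in> box M D" "h' - p' \<in> K"
    by (auto simp: box_mod_def)
  have "(h - p) + (h' - p') \<in> K" using p by (intro add)
  hence "(h + h') - (p + p') \<in> K" by (simp add: algebra_simps)
  thus "h + h' \<in> box_mod M D"
    using subspace_polyD(2)[OF subspace_box p(1,3)] by (rule box_modI[rotated])
next
  fix c h assume "h \<in> box_mod M D"
  hence "cst c * h \<in> box_mod M (0 + D)"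
    by (intro box_mod_mult set_mp[OF box_subset_box_mod cst_box])
  thus "cst c * h \<in> box_mod M D" by simp
qed

text \<open>Every additional factor \<open>g\<close> costs degree \<open>d\<close>; this brings
  different powers of \<open>g\<close> to a common exponent.\<close>

lemma box_mod_prod_power:
  assumes "g \<in> box M d" "k \<le> l" "g ^ k * h \<in> box_mod M D"
  shows "g ^ l * h \<in> box_mod M (d * (l - k) + D)"
proof -
  have "g ^ (l - k) * (g ^ k * h) \<in> box_mod M (d * (l - k) + D)"
    using box_subset_box_mod box_power[OF assms(1)] assms(3) by (intro box_mod_mult) auto
  thus ?thesis using assms(2) by (simp add: mult.assoc[symmetric] power_add[symmetric])
qed

text \<open>
  For \<open>j = r + n + 1\<close> with \<open>n > r\<close>, the element \<open>{f, var n}\<close> of \<open>K\<close> expresses \<open>\<partial>\<^sub>rf \<cdot> var j\<close>, up to the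
  nonzero factor \<open>n - r\<close>, by variables of smaller index.
\<close>

lemma pdiff_power_var_box_mod:
  assumes f: "f \<in> K" "f \<in> box M d" and r: "r \<in> indets f" "indets f \<subseteq> {..r}" and M: "2 * r + 2 \<le> M"
  shows "pdiff r f ^ j * var j \<in> box_mod M (d * j + 1)"
proof (induction j rule: less_induct)
  case (less j)
  define g where "g = pdiff r f"
  have pd: "pdiff i f \<in> box M d" for i
    using pdiff_box[OF f(2), of i] box_mono[of M M "d - 1" d] by auto
  show ?case
  proof (cases "j < M")
    case True
    have "g ^ j * var j \<in> box M (d * j + 1)"
      unfolding g_def by (intro box_mult box_power pd var_box True) simp
    thus ?thesis using box_subset_box_mod unfolding g_def by blast
  next
    case False
    \<comment> \<open>For \<open>j \<ge> M\<close> the hypothesis \<open>2 * r + 2 \<le> M\<close>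
      yields \<open>n > r\<close>, so that \<open>n - r\<close> is invertible in characteristic
      zero.\<close>
    define n where "n = j - r - 1"
    have n: "j = r + n + 1" "n > r" using False M by (auto simp: n_def)
    let ?t = "\<lambda>i. cst (of_int (int n - int i)) * pdiff i f * var (i + n + 1)"
    \<comment> \<open>Here \<open>i < r\<close>, so this variable precedes \<open>var j\<close> and
      the induction hypothesis applies, its exponent padded to \<open>j - 1\<close>. The factor
      \<open>pdiff i f\<close> contributes the remaining degree \<open>d\<close>.\<close>
    have small: "g ^ (j - 1) * ?t i \<in> box_mod M (d * j + 1)" if i: "i \<in> indets f - {r}" for i
    proof -
      have ij: "i + n + 1 < j" using i r(2) n by force
      have "g ^ (j - 1) * var (i + n + 1) \<in> box_mod M (d * (j - 1 - (i + n + 1)) + (d * (i + n + 1) + 1))"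
        using ij less.IH[OF ij] pd unfolding g_def by (intro box_mod_prod_power) auto
      also have "d * (j - 1 - (i + n + 1)) + (d * (i + n + 1) + 1) = d * (j - 1) + 1"
        using ij by (simp add: add.assoc[symmetric] distrib_left[symmetric] del: add_Suc_right)
      finally have "(cst (of_int (int n - int i)) * pdiff i f) * (g ^ (j - 1) * var (i + n + 1))
          \<in> box_mod M ((0 + d) + (d * (j - 1) + 1))"
        by (intro box_mod_mult[OF box_mod_mult[OF set_mp[OF box_subset_box_mod cst_box]
              set_mp[OF box_subset_box_mod pd]]])
      also have "(0 + d) + (d * (j - 1) + 1) = d * j + 1" using n by simp
      finally show ?thesis by (simp add: mult_ac)
    qed
    have 1: "g ^ (j - 1) * witt_bracket f (var n) \<in> box_mod M (d * j + 1)"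
      using mult[OF bracket[OF f(1)]] subset_box_mod by blast
    have 2: "g ^ (j - 1) * witt_bracket f (var n) =
        g ^ (j - 1) * ?t r + (\<Sum>i\<in>indets f - {r}. g ^ (j - 1) * ?t i)"
      unfolding witt_bracket_var_right sum_distrib_left
      by (rule sum.remove[OF finite_indets r(1)])
    have 3: "(\<Sum>i\<in>indets f - {r}. g ^ (j - 1) * ?t i) \<in> box_mod M (d * j + 1)"
      by (rule subspace_poly_sum[OF subspace_box_mod small])
    have "g ^ (j - 1) * ?t r \<in> box_mod M (d * j + 1)"
      using subspace_poly_diff[OF subspace_box_mod 1 3] unfolding 2
      by (simp only: add_diff_cancel_right')
    hence "cst (inverse (of_int (int n - int r))) * (g ^ (j - 1) * ?t r) \<in> box_mod M (d * j + 1)"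
      by (rule subspace_polyD(3)[OF subspace_box_mod])
    also have "cst (inverse (of_int (int n - int r))) * (g ^ (j - 1) * ?t r) =
        cst (inverse (of_int (int n - int r))) * cst (of_int (int n - int r)) * (g ^ (j - 1) * g) * var j"
      by (simp add: g_def n(1) mult_ac)
    also have "cst (inverse (of_int (int n - int r))) * cst (of_int (int n - int r)) = (1 :: 'k infpoly)"
    proof -
      have "of_int (int n - int r) \<noteq> (0 :: 'k)" using n(2) unfolding of_int_eq_0_iff by simp
      thus ?thesis unfolding cst_mult[symmetric] by simp
    qed
    also have "g ^ (j - 1) * g = g ^ j" by (rule power_minus_mult) (simp add: n(1))
    finally show ?thesis by (simp add: g_def)
  qed
qed

end

section \<open>Domination by polynomials in finitely many variables\<close>

lemma polys_on_subset_subspace: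
  fixes U :: "'k::comm_ring_1 infpoly set"
  assumes U: "subspace_poly U" and T: "\<And>m. m \<in> T \<Longrightarrow> Poly_Mapping.single m 1 \<in> U"
  shows "polys_on T \<subseteq> U"
proof
  fix f :: "'k infpoly" assume f: "f \<in> polys_on T"
  have "f = (\<Sum>m\<in>Poly_Mapping.keys f. cst (Poly_Mapping.lookup f m) * Poly_Mapping.single m 1)"
    by (rule poly_mapping_eqI) (auto simp: mult_single lookup_sum lookup_single when_def in_keys_iff)
  also have "\<dots> \<in> U"
    using f by (intro subspace_poly_sum[OF U] subspace_polyD(3)[OF U] T) (auto simp: polys_on_def)
  finally show "f \<in> U" .
qed

lemma monomial_induct [case_names zero mult]:
  assumes "P (0 :: nat \<Rightarrow>\<^sub>0 nat)" "\<And>i m. P m \<Longrightarrow> P (Poly_Mapping.single i 1 + m)"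
  shows "P m"
proof -
  have "P (Poly_Mapping.single i k + m)" if "P m" for i k m
  proof (induction k)
    case (Suc k)
    have "Poly_Mapping.single i (Suc k) + m = Poly_Mapping.single i 1 + (Poly_Mapping.single i k + m)"
      by (simp add: single_add[symmetric] add.assoc[symmetric])
    thus ?case using assms(2)[OF Suc] by simp
  qed (use that in simp)
  note * = this
  show ?thesis
  proof (induction m rule: update_induct)
    case (update m a b)
    have "Poly_Mapping.update a b m = Poly_Mapping.single a b + m"
      using update(1) by (intro poly_mapping_eqI)
        (auto simp: lookup_update lookup_add lookup_single when_def in_keys_iff)
    thus ?case using *[OF update(3)] by simp
  qed (use assms(1) in simp)
qed

lemma monomial_Suc: "Poly_Mapping.single (Poly_Mapping.single i 1 + m) 1 = var i * Poly_Mapping.single m 1"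
  by (simp add: var_def mult_single)

text \<open>Each \<open>var i\<close> is absorbed by \<open>Suc i\<close> factors of the derivative,
  and these numbers add up to the weight of a monomial. Further factors bring all monomials of
  weight at most \<open>n\<close> to the common exponent \<open>n\<close>, where linearity
  applies.\<close>

lemma (in poisson_radical) pdiff_power_wle_box_mod:
  assumes f: "f \<in> K" "f \<in> box M d" and r: "r \<in> indets f" "indets f \<subseteq> {..r}" and M: "2 * r + 2 \<le> M"
    and h: "h \<in> wle n"
  shows "pdiff r f ^ n * h \<in> box_mod M ((d + 1) * n)"
proof -
  define g where "g = pdiff r f"
  have g: "g \<in> box M d"
    using pdiff_box[OF f(2), of r] box_mono[of M M "d - 1" d] by (auto simp: g_def)
  have mono: "g ^ l * h \<in> box_mod M ((d + 1) * l)"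
    if "g ^ k * h \<in> box_mod M ((d + 1) * k)" "k \<le> l" for k l h
  proof -
    have "d * (l - k) + (d + 1) * k \<le> (d + 1) * (l - k) + (d + 1) * k" by simp
    also have "\<dots> = (d + 1) * l" using that(2) by (simp only: distrib_left[symmetric]) simp
    finally show ?thesis
      using box_mod_prod_power[OF g that(2,1)] box_mod_mono by blast
  qed
  have monom: "g ^ wdeg Suc m * Poly_Mapping.single m 1 \<in> box_mod M ((d + 1) * wdeg Suc m)" for m
  proof (induction m rule: monomial_induct)
    case zero
    show ?case using set_mp[OF box_subset_box_mod one_box] by (simp add: wdeg_zero)
  next
    case (mult i m)
    \<comment> \<open>The power \<open>g ^ i\<close> already suffices; one more factor makes the
      exponent equal to the weight \<open>Suc i\<close>. The degree stays in range as
      \<open>d + (d * i + 1) \<le> (d + 1) * Suc i\<close>.\<close>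
    have "g ^ Suc i * var i \<in> box_mod M (d * 1 + (d * i + 1))"
      using box_mod_prod_power[OF g, of i "Suc i" "var i" "d * i + 1"]
        pdiff_power_var_box_mod[OF f r M, of i] by (simp add: g_def)
    hence "g ^ Suc i * var i \<in> box_mod M ((d + 1) * Suc i)"
      using set_mp[OF box_mod_mono[of "d * 1 + (d * i + 1)" "(d + 1) * Suc i" M]] by simp
    from box_mod_mult[OF this mult]
    have "(g ^ Suc i * var i) * (g ^ wdeg Suc m * Poly_Mapping.single m 1)
      \<in> box_mod M ((d + 1) * wdeg Suc (Poly_Mapping.single i 1 + m))"
      by (simp only: distrib_left[symmetric] wdeg_add wdeg_single mult_1_right)
    also have "(g ^ Suc i * var i) * (g ^ wdeg Suc m * Poly_Mapping.single m 1) =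
        g ^ wdeg Suc (Poly_Mapping.single i 1 + m) * Poly_Mapping.single (Poly_Mapping.single i 1 + m) 1"
      unfolding monomial_Suc wdeg_add wdeg_single mult_1_right power_add by (simp only: mult_ac)
    finally show ?case .
  qed
  have "subspace_poly {h. g ^ n * h \<in> box_mod M ((d + 1) * n)}"
    using subspace_polyD[OF subspace_box_mod]
    by (auto simp: subspace_poly_def distrib_left mult.left_commute)
  hence "wle n \<subseteq> {h. g ^ n * h \<in> box_mod M ((d + 1) * n)}"
    unfolding wle_def by (rule polys_on_subset_subspace) (use mono[OF monom] in auto)
  thus ?thesis using h by (auto simp: g_def)
qed

text \<open>
  Up to the factor \<open>s\<close>, the image in the quotient by \<open>K\<close> of the polynomials of weight at most \<open>n\<close> is
  no larger than that of the polynomials of degree at most \<open>C * n\<close> in \<open>M\<close> variables.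
\<close>

definition dominated :: "'k::field infpoly set \<Rightarrow> nat \<Rightarrow> nat \<Rightarrow> nat \<Rightarrow> bool"
  where "dominated K M s C \<longleftrightarrow> (\<forall>n. \<forall>B\<subseteq>wle n. indep_mod K B (\<lambda>x. x) \<longrightarrow>
    (\<exists>D\<subseteq>box M (C * n). indep_mod K D (\<lambda>x. x) \<and> card B \<le> s * card D))"

text \<open>Multiplication by \<open>pdiff r f ^ n\<close> is injective modulo \<open>K\<close> and
  sends \<open>wle n\<close> into the box modulo \<open>K\<close>. Representatives of the products
  in the box thus inherit independence.\<close>

lemma (in poisson_radical) dominated_nonzerodivisor:
  assumes f: "f \<in> K" "f \<in> box M d" and r: "r \<in> indets f" "indets f \<subseteq> {..r}" and M: "2 * r + 2 \<le> M"
    and nzd: "\<And>h. h * pdiff r f \<in> K \<Longrightarrow> h \<in> K"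
  shows "dominated K M 1 (d + 1)"
  unfolding dominated_def
proof (intro allI impI)
  fix n B assume B: "B \<subseteq> wle n" "indep_mod K B (\<lambda>x. x)"
  define g where "g = pdiff r f ^ n"
  have g_nzd: "h \<in> K" if "g * h \<in> K" for h
  proof -
    have "h \<in> K" if "pdiff r f ^ l * h \<in> K" for l
      using that
    proof (induction l)
      case (Suc l)
      from Suc.prems have "(pdiff r f ^ l * h) * pdiff r f \<in> K" by (simp add: mult_ac)
      from Suc.IH[OF nzd[OF this]] show ?case .
    qed simp
    thus ?thesis using that by (simp add: g_def)
  qed
  have "\<forall>b\<in>B. \<exists>p. p \<in> box M ((d + 1) * n) \<and> g * b - p \<in> K"
  proof
    fix b assume "b \<in> B"
    hence "b \<in> wle n" using B(1) by blast
    from pdiff_power_wle_box_mod[OF f r M this]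
    show "\<exists>p. p \<in> box M ((d + 1) * n) \<and> g * b - p \<in> K"
      unfolding box_mod_def g_def by blast
  qed
  then obtain p where p: "\<forall>b\<in>B. p b \<in> box M ((d + 1) * n) \<and> g * b - p b \<in> K"
    by (rule bchoice[THEN exE])
  have "indep_mod K B p"
    unfolding indep_mod_def
  proof (intro conjI allI impI)
    fix c assume *: "(\<Sum>b\<in>B. cst (c b) * p b) \<in> K"
    have "(\<Sum>b\<in>B. cst (c b) * (g * b - p b)) \<in> K"
      using p by (intro subspace_poly_sum[OF subspace] mult) auto
    from add[OF this *] have "g * (\<Sum>b\<in>B. cst (c b) * b) \<in> K"
      by (simp add: sum.distrib[symmetric] sum_distrib_left algebra_simps)
    thus "\<forall>b\<in>B. c b = 0" using indep_modD[OF B(2)] g_nzd by blast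
  qed (use B in \<open>auto simp: indep_mod_def\<close>)
  note im = indep_mod_image[OF subspace this]
  show "\<exists>D\<subseteq>box M ((d + 1) * n). indep_mod K D (\<lambda>x. x) \<and> card B \<le> 1 * card D"
    by (rule exI[of _ "p ` B"]) (use p im card_image[OF im(1)] in auto)
qed

section \<open>Decomposition of the ideal and induction on the degree\<close>

lemma dominated_mono:
  assumes "dominated K M s C" "M \<le> M'" "C \<le> C'"
  shows "dominated K M' s C'"
  unfolding dominated_def
proof (intro allI impI)
  fix n B assume "B \<subseteq> wle n" "indep_mod K B (\<lambda>x. x)"
  then obtain D where "D \<subseteq> box M (C * n)" "indep_mod K D (\<lambda>x. x)" "card B \<le> s * card D"
    using assms(1) unfolding dominated_def by metis
  moreover have "box M (C * n) \<subseteq> (box M' (C' * n) :: 'a infpoly set)"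
    using assms(2,3) by (intro box_mono mult_le_mono1)
  ultimately show "\<exists>D\<subseteq>box M' (C' * n). indep_mod K D (\<lambda>x. x) \<and> card B \<le> s * card D"
    by blast
qed

text \<open>By \<open>indep_mod_Int\<close> the cardinality splits into those of sets independent
  modulo \<open>K1\<close> and modulo \<open>K2\<close>, each dominated by a set in a box. The
  larger of these two sets is still independent modulo the intersection and bounds both parts, so
  the factors add.\<close>

lemma dominated_Int:
  assumes K: "subspace_poly K1" "subspace_poly K2"
    and "dominated K1 M1 s1 C1" "dominated K2 M2 s2 C2"
  shows "dominated (K1 \<inter> K2) (max M1 M2) (s1 + s2) (max C1 C2)"
  unfolding dominated_def
proof (intro allI impI)
  fix n B assume B: "B \<subseteq> wle n" "indep_mod (K1 \<inter> K2) B (\<lambda>x. x)"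
  obtain B1 B2 where B12: "B1 \<subseteq> wle n" "B2 \<subseteq> wle n" "indep_mod K1 B1 (\<lambda>x. x)" "indep_mod K2 B2 (\<lambda>x. x)"
      "card B = card B1 + card B2"
    using indep_mod_Int[OF K subspace_wle B] .
  obtain D1 where D1: "D1 \<subseteq> box M1 (C1 * n)" "indep_mod K1 D1 (\<lambda>x. x)" "card B1 \<le> s1 * card D1"
    using assms(3) B12(1-4) unfolding dominated_def by metis
  obtain D2 where D2: "D2 \<subseteq> box M2 (C2 * n)" "indep_mod K2 D2 (\<lambda>x. x)" "card B2 \<le> s2 * card D2"
    using assms(4) B12(1-4) unfolding dominated_def by metis
  define D where "D = (if card D1 \<ge> card D2 then D1 else D2)"
  have "box M1 (C1 * n) \<subseteq> box (max M1 M2) (max C1 C2 * n)"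
    and "box M2 (C2 * n) \<subseteq> box (max M1 M2) (max C1 C2 * n)"
    by (rule box_mono; simp)+
  hence "D \<subseteq> box (max M1 M2) (max C1 C2 * n)" using D1(1) D2(1) unfolding D_def by auto
  moreover have "indep_mod (K1 \<inter> K2) D (\<lambda>x. x)"
    using indep_mod_antimono[OF D1(2)] indep_mod_antimono[OF D2(2)] by (auto simp: D_def)
  moreover have "card B \<le> (s1 + s2) * card D"
  proof -
    have "s1 * card D1 \<le> s1 * card D" "s2 * card D2 \<le> s2 * card D" by (auto simp: D_def)
    thus ?thesis using B12(5) D1(3) D2(3) unfolding distrib_right by linarith
  qed
  ultimately show "\<exists>D\<subseteq>box (max M1 M2) (max C1 C2 * n). indep_mod (K1 \<inter> K2) D (\<lambda>x. x)
      \<and> card B \<le> (s1 + s2) * card D" by blast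
qed

lemma poisson_radical_dominated:
  assumes "poisson_radical K" "f \<in> K" "f \<noteq> 0" "\<And>m. m \<in> Poly_Mapping.keys f \<Longrightarrow> wdeg (\<lambda>_. 1) m \<le> d"
  shows "\<exists>M s C. dominated K M s C"
  using assms
proof (induction d arbitrary: K f rule: less_induct)
  case (less d)
  interpret poisson_radical K by fact
  show ?case
  proof (cases "indets f = {}")
    case True
    then obtain m where "m \<in> Poly_Mapping.keys f" using less.prems(3) by fastforce
    hence keys: "Poly_Mapping.keys f = {0}" using True by (auto simp: indets_def)
    define c where "c = Poly_Mapping.lookup f 0"
    have lookup_0: "Poly_Mapping.lookup f k \<noteq> 0 \<longleftrightarrow> k = 0" for k
      using keys in_keys_iff[of k f] by simp
    hence c: "f = cst c" "c \<noteq> 0"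
      by (auto intro!: poly_mapping_eqI simp: c_def lookup_single when_def)
    have UNIV: "h \<in> K" for h
    proof -
      have "h * cst (inverse c) * f \<in> K" by (rule mult[OF less.prems(2)])
      thus ?thesis using c(2) by (simp add: c(1) mult.assoc cst_mult[symmetric])
    qed
    have "B = {}" if "indep_mod K B (\<lambda>x. x)" for B
    proof (rule ccontr)
      assume "B \<noteq> {}"
      then obtain b where "b \<in> B" by blast
      from indep_modD[OF that UNIV this, of "\<lambda>_. 1"] show False by simp
    qed
    \<comment> \<open>A nonzero constant in \<open>K\<close> makes \<open>K\<close> the whole ring,
      modulo which only the empty set is independent.\<close>
    hence "dominated K 0 0 0" unfolding dominated_def by (metis card.empty empty_subsetI le0)
    thus ?thesis by blast
  next
    case False
    define r where "r = Max (indets f)"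
    have r: "r \<in> indets f" "indets f \<subseteq> {..r}"
      using False finite_indets[of f] by (auto simp: r_def)
    define g where "g = pdiff r f"
    define K1 where "K1 = {h. h * g \<in> K}"
    define K2 where "K2 = {h. \<forall>k\<in>K1. h * k \<in> K}"
    interpret K1: poisson_radical K1 unfolding K1_def by (rule colon)
    interpret K2: poisson_radical K2 unfolding K2_def by (rule colon_set)
    have K12: "K1 \<inter> K2 = K"
    proof (intro equalityI subsetI)
      fix h assume "h \<in> K1 \<inter> K2"
      \<comment> \<open>Since \<open>h\<close> lies in \<open>K1\<close> and multiplies
        \<open>K1\<close> into \<open>K\<close>, its square is in \<open>K\<close>.\<close>
      thus "h \<in> K" using square unfolding K2_def by blast
    next
      fix h assume "h \<in> K"
      thus "h \<in> K1 \<inter> K2" by (auto simp: K1_def K2_def intro: mult_right)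
    qed
    have "f \<in> box (2 * r + 2) d"
      using r(2) less.prems(4) by (force simp: box_def polys_on_def indets_def)
    \<comment> \<open>Radicality makes \<open>g\<close> a nonzerodivisor modulo \<open>K1\<close>:
      multiplying \<open>h * g * g \<in> K\<close> by \<open>h\<close> gives the square of
      \<open>h * g\<close>.\<close>
    moreover have "h \<in> K1" if "h * g \<in> K1" for h
    proof -
      have "h * (h * g * g) \<in> K" using that mult by (simp add: K1_def)
      hence "(h * g) * (h * g) \<in> K" by (simp add: mult_ac)
      thus ?thesis unfolding K1_def by (intro CollectI) (rule square)
    qed
    moreover have "f \<in> K1" using less.prems(2) by (auto simp: K1_def intro: mult_right)
    ultimately have dom1: "dominated K1 (2 * r + 2) 1 (d + 1)"
      by (intro K1.dominated_nonzerodivisor[OF _ _ r]) (auto simp: g_def)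
    have "g \<in> K2" by (auto simp: K2_def K1_def mult.commute)
    moreover have "g \<noteq> 0" unfolding g_def by (rule pdiff_nonzero[OF r(1)])
    moreover have deg_g: "wdeg (\<lambda>_. 1) m + 1 \<le> d" if "m \<in> Poly_Mapping.keys g" for m
      using less.prems(4)[OF keys_pdiff[of m r f]] that by (simp add: g_def wdeg_add wdeg_single)
    \<comment> \<open>The case \<open>d = 0\<close> is excluded because the nonzero \<open>g\<close>
      has a monomial, of degree below \<open>d\<close>.\<close>
    moreover have "d - 1 < d"
    proof -
      obtain m where "m \<in> Poly_Mapping.keys g" using \<open>g \<noteq> 0\<close> by fastforce
      from deg_g[OF this] show ?thesis by simp
    qed
    ultimately obtain M s C where "dominated K2 M s C"
      using less.IH[of "d - 1" K2 g] K2.poisson_radical_axioms by fastforce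
    from dominated_Int[OF K1.subspace K2.subspace dom1 this] show ?thesis
      unfolding K12 by blast
  qed
qed

section \<open>Growth\<close>

text \<open>Passing from \<open>n\<close> to \<open>C * n\<close> changes \<open>ln n\<close> by the
  constant \<open>ln C\<close>, and the factor \<open>s\<close> contributes the constant
  \<open>ln s\<close>; both vanish after division by \<open>ln n\<close>.\<close>

lemma growth_exponent_le:
  assumes C: "C \<ge> 1" and le: "\<And>n. n \<ge> 1 \<Longrightarrow> a n \<le> s * b (C * n)"
  shows "growth_exponent a \<le> growth_exponent b"
proof (rule dense_ge)
  fix x assume x: "growth_exponent b < x"
  show "growth_exponent a \<le> x"
  proof (cases x)
    case (real t)
    have "eventually (\<lambda>n. ereal (log (real n) (real (b n))) < ereal t) sequentially"
      using x unfolding real growth_exponent_def by (rule Limsup_lessD)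
    then obtain N where N: "\<And>n. n \<ge> N \<Longrightarrow> log (real n) (real (b n)) < t"
      by (auto simp: eventually_sequentially)
    have ln_nat: "ln (real n) \<ge> 0" for n by (cases n) auto
    \<comment> \<open>Logarithms of natural numbers are nonnegative, also at 0 because
      \<open>ln 0 = 0\<close>; hence their strict upper bound \<open>t\<close> is positive.\<close>
    have "0 \<le> log (real (N + 2)) (real (b (N + 2)))"
      unfolding log_def by (intro divide_nonneg_nonneg ln_nat)
    also have "\<dots> < t" by (rule N) simp
    finally have t: "t > 0" .
    define c where "c = ln (real s) + t * ln (real C)"
    have c: "c \<ge> 0" using t ln_nat by (simp add: c_def)
    \<comment> \<open>For \<open>n \<ge> 2\<close> the divisor \<open>ln n\<close> is positive. If
      \<open>a n = 0\<close>, the left-hand side is 0 and the signs of \<open>c\<close> and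
      \<open>t\<close> suffice.\<close>
    have bound: "log (real n) (real (a n)) \<le> c / ln (real n) + t" if n: "n \<ge> N + 2" for n
    proof (cases "a n = 0")
      case True
      thus ?thesis using c t ln_nat by (simp add: log_def)
    next
      case False
      hence pos: "s > 0" "b (C * n) > 0" using le[of n] n by (auto intro!: Nat.gr0I)
      have ln_n: "ln (real n) > 0" using n by simp
      have Cn: "C * n \<ge> n" using C by simp
      have "log (real (C * n)) (real (b (C * n))) < t" by (rule N) (use Cn n in linarith)
      moreover have "ln (real (C * n)) > 0" using Cn n by (intro ln_gt_zero) linarith
      ultimately have "ln (real (b (C * n))) < t * ln (real (C * n))"
        by (simp add: log_def pos_divide_less_eq)
      also have "ln (real (C * n)) = ln (real C) + ln (real n)"
        using C n by (simp add: ln_mult)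
      finally have b: "ln (real (b (C * n))) \<le> t * ln (real C) + t * ln (real n)"
        by (simp add: distrib_left)
      have "real (a n) \<le> real s * real (b (C * n))"
        using le[of n] n unfolding of_nat_mult[symmetric] of_nat_le_iff by simp
      hence "ln (real (a n)) \<le> ln (real s * real (b (C * n)))"
        using False by (subst ln_le_cancel_iff) auto
      also have "\<dots> = ln (real s) + ln (real (b (C * n)))" using pos by (simp add: ln_mult)
      also have "\<dots> \<le> c + t * ln (real n)" using b by (simp add: c_def)
      finally show ?thesis using ln_n by (simp add: log_def field_simps)
    qed
    have "(\<lambda>n. c / ln (real n)) \<longlonglongrightarrow> 0"
      by (intro tendsto_divide_0[OF tendsto_const] filterlim_at_top_imp_at_infinity
          filterlim_compose[OF ln_at_top filterlim_real_sequentially])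
    hence "(\<lambda>n. c / ln (real n) + t) \<longlonglongrightarrow> 0 + t"
      by (intro tendsto_add tendsto_const)
    hence "limsup (\<lambda>n. ereal (c / ln (real n) + t)) = ereal t"
      by (intro lim_imp_Limsup) (simp_all add: tendsto_ereal)
    moreover have "growth_exponent a \<le> limsup (\<lambda>n. ereal (c / ln (real n) + t))"
      unfolding growth_exponent_def
      by (intro Limsup_mono eventually_sequentiallyI[of "N + 2"]) (use bound in simp)
    ultimately show ?thesis by (simp add: real)
  qed (use x in auto)
qed

text \<open>The inequality \<open>n + 1 \<le> 2 * n\<close> reduces the claim to
  \<open>n ^ M\<close> by rescaling, and there the logarithm to base \<open>n\<close> is exactly
  \<open>M\<close>.\<close>

lemma growth_exponent_polynomial:
  assumes "\<And>n. b n \<le> (n + 1) ^ M"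
  shows "growth_exponent b < \<infinity>"
proof -
  have "growth_exponent b \<le> growth_exponent (\<lambda>n. n ^ M)"
  proof (rule growth_exponent_le)
    fix n :: nat assume "n \<ge> 1"
    hence "(n + 1) ^ M \<le> (2 * n) ^ M" by (intro power_mono) auto
    thus "b n \<le> 1 * (2 * n) ^ M" using assms[of n] by simp
  qed simp
  also have "\<dots> \<le> limsup (\<lambda>n. ereal (real M))"
    unfolding growth_exponent_def
  proof (intro Limsup_mono eventually_sequentiallyI[of 2])
    fix n :: nat assume "n \<ge> 2"
    thus "ereal (log (real n) (real (n ^ M))) \<le> ereal (real M)"
      by (simp add: log_nat_power)
  qed
  also have "\<dots> = ereal (real M)" by (rule Limsup_const) simp
  finally show ?thesis by (rule le_less_trans) simp
qed

section \<open>Counting monomials in finitely many variables\<close>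

definition monomials :: "nat \<Rightarrow> nat \<Rightarrow> (nat \<Rightarrow>\<^sub>0 nat) set"
  where "monomials M D = {m. Poly_Mapping.keys m \<subseteq> {..<M} \<and> wdeg (\<lambda>_. 1) m \<le> D}"

lemma box_eq_polys_on: "box M D = polys_on (monomials M D)"
  by (simp add: box_def monomials_def)

text \<open>A monomial is determined by its \<open>M\<close> exponents, each of them at most
  \<open>D\<close>.\<close>

lemma card_monomials: "finite (monomials M D)" "card (monomials M D) \<le> (D + 1) ^ M"
proof -
  let ?h = "\<lambda>m. restrict (Poly_Mapping.lookup m) {..<M}"
  have inj: "inj_on ?h (monomials M D)"
  proof (rule inj_onI, rule poly_mapping_eqI)
    fix m m' i assume m: "m \<in> monomials M D" "m' \<in> monomials M D" "?h m = ?h m'"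
    show "Poly_Mapping.lookup m i = Poly_Mapping.lookup m' i"
    proof (cases "i < M")
      case True
      thus ?thesis using fun_cong[OF m(3), of i] by simp
    next
      case False
      hence "i \<notin> Poly_Mapping.keys m" "i \<notin> Poly_Mapping.keys m'"
        using m(1,2) by (auto simp: monomials_def)
      thus ?thesis by (simp add: in_keys_iff)
    qed
  qed
  have sub: "?h ` monomials M D \<subseteq> {..<M} \<rightarrow>\<^sub>E {..D}"
  proof (rule image_subsetI)
    fix m assume m: "m \<in> monomials M D"
    have "Poly_Mapping.lookup m i \<le> D" for i
    proof (cases "i \<in> Poly_Mapping.keys m")
      case True
      hence "Poly_Mapping.lookup m i \<le> wdeg (\<lambda>_. 1) m"
        unfolding wdeg_def by simp (rule member_le_sum; simp)
      thus ?thesis using m by (simp add: monomials_def)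
    qed (simp add: in_keys_iff)
    thus "?h m \<in> {..<M} \<rightarrow>\<^sub>E {..D}" by auto
  qed
  have fin: "finite ({..<M} \<rightarrow>\<^sub>E {..D})" by (intro finite_PiE) auto
  show "finite (monomials M D)"
    by (rule finite_imageD[OF finite_subset[OF sub fin] inj])
  have "card (monomials M D) = card (?h ` monomials M D)" by (rule card_image[OF inj, symmetric])
  also have "\<dots> \<le> card ({..<M} \<rightarrow>\<^sub>E {..D})" by (rule card_mono[OF fin sub])
  also have "\<dots> = (D + 1) ^ M" by (simp add: card_PiE)
  finally show "card (monomials M D) \<le> (D + 1) ^ M" .
qed

text \<open>As \<open>0 \<in> K\<close>, independence modulo \<open>K\<close> implies ordinary
  independence, and the monomials in \<open>T\<close> span the space, so the exchange lemma
  applies.\<close>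

lemma indep_mod_card_le:
  fixes K :: "'k::field infpoly set"
  assumes B: "indep_mod K B (\<lambda>x. x)" "B \<subseteq> polys_on T" and "0 \<in> K" "finite T"
  shows "card B \<le> card T"
proof -
  interpret V: Vector_Spaces.vector_space "\<lambda>(c::'k) (f::'k infpoly). cst c * f"
    by unfold_locales (simp_all add: distrib_left distrib_right single_add cst_mult mult.assoc)
  let ?M = "(\<lambda>m. Poly_Mapping.single m 1 :: 'k infpoly) ` T"
  have "V.independent B"
    using B(1) \<open>0 \<in> K\<close> by (auto simp: indep_mod_def V.dependent_finite)
  moreover have "subspace_poly (V.span ?M)"
    by (simp add: subspace_poly_def V.span_zero V.span_add V.span_scale)
  hence "polys_on T \<subseteq> V.span ?M"
    by (rule polys_on_subset_subspace) (auto intro: V.span_base)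
  ultimately have "card B \<le> card ?M"
    using V.independent_span_bound[of ?M B] B(2) assms(4) by auto
  also have "\<dots> \<le> card T" by (rule card_image_le[OF assms(4)])
  finally show ?thesis .
qed

section \<open>The quotient algebra\<close>

lemma SW_simps [simp]:
  "carrier SW = UNIV" "mult SW = (*)" "one SW = 1" "zero SW = 0" "add SW = (+)"
  "smult SW c f = cst c * f" "pbracket SW = witt_bracket"
  by (simp_all add: SW_def)

locale witt_quot =
  fixes K :: "'k::field_char_0 infpoly set"
  assumes poisson_ideal: "poisson_ideal K SW"
    and radical_ideal: "radical_ideal K SW"
begin

sublocale ideal K "SW :: ('k, 'k infpoly) poisson_alg"
  using poisson_ideal by (simp add: poisson_ideal_def)

sublocale poisson_radical K
proof
  show "0 \<in> K" using additive_subgroup.zero_closed[OF is_additive_subgroup] by simp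
  show "f + g \<in> K" if "f \<in> K" "g \<in> K" for f g using additive_subgroup.a_closed[OF is_additive_subgroup that] by simp
  show "h * f \<in> K" if "f \<in> K" for f h using I_l_closed[OF that, of h] by simp
  show "witt_bracket f h \<in> K" if "f \<in> K" for f h
    using poisson_ideal that by (simp add: poisson_ideal_def)
  fix f :: "'k infpoly" assume *: "f * f \<in> K"
  have "f [^]\<^bsub>SW :: ('k, 'k infpoly) poisson_alg\<^esub> (2::nat) = f * f"
    by (simp add: numeral_2_eq_2)
  thus "f \<in> K" using * radical_ideal unfolding radical_ideal_def by (metis SW_simps(1) UNIV_I)
qed

abbreviation Q :: "('k, 'k infpoly set) poisson_alg"
  where "Q \<equiv> poisson_quot SW K"

text \<open>The coset of \<open>f\<close>, written as a set comprehension so that equality of cosets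
  becomes a congruence modulo \<open>K\<close>.\<close>

definition proj :: "'k infpoly \<Rightarrow> 'k infpoly set"
  where "proj f = {h. h - f \<in> K}"

lemma proj_eq_iff: "proj f = proj g \<longleftrightarrow> f - g \<in> K"
proof
  assume "proj f = proj g"
  moreover have "f \<in> proj f" by (simp add: proj_def zero)
  ultimately show "f - g \<in> K" by (simp add: proj_def)
next
  assume fg: "f - g \<in> K"
  have "h - f \<in> K \<longleftrightarrow> h - g \<in> K" for h
    using add[OF _ fg, of "h - f"] diff[OF _ fg, of "h - g"] by auto
  thus "proj f = proj g" by (simp add: proj_def)
qed

lemma coset_eq_proj: "K +>\<^bsub>SW\<^esub> f = proj f"
  by (auto simp: a_r_coset_def' proj_def intro!: bexI[of _ "_ - f"])

lemma carrier_Q: "carrier Q = range proj"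
  by (auto simp: poisson_quot_def FactRing_def A_RCOSETS_def' coset_eq_proj)

lemma proj_self: "f \<in> proj f"
  by (simp add: proj_def zero)

lemma Q_add: "proj f \<oplus>\<^bsub>Q\<^esub> proj g = proj (f + g)"
  using a_rcos_sum[of f g] by (simp add: poisson_quot_def FactRing_def coset_eq_proj)

lemma Q_mult: "proj f \<otimes>\<^bsub>Q\<^esub> proj g = proj (f * g)"
  using rcoset_mult_add[of f g] by (simp add: poisson_quot_def FactRing_def coset_eq_proj)

lemma Q_one: "\<one>\<^bsub>Q\<^esub> = proj 1"
  by (simp add: poisson_quot_def FactRing_def coset_eq_proj)

lemma Q_zero: "\<zero>\<^bsub>Q\<^esub> = proj 0"
  by (simp add: poisson_quot_def FactRing_def proj_def)

text \<open>The quotient defines this operation as a union over representatives. All cosets in the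
  union agree, and \<open>f\<close> itself is a representative.\<close>

lemma Q_smult: "c \<odot>\<^bsub>Q\<^esub> proj f = proj (cst c * f)"
proof -
  have eq: "proj (cst c * h) = proj (cst c * f)" if "h \<in> proj f" for h
    using mult[of "h - f" "cst c"] that unfolding proj_eq_iff by (simp add: proj_def algebra_simps)
  have "c \<odot>\<^bsub>Q\<^esub> proj f = (\<Union>h\<in>proj f. proj (cst c * h))"
    by (simp add: poisson_quot_def coset_eq_proj)
  also have "\<dots> = (\<Union>h\<in>proj f. proj (cst c * f))"
    by (intro SUP_cong refl eq)
  also have "\<dots> = proj (cst c * f)" using proj_self by auto
  finally show ?thesis .
qed

lemma Q_bracket: "\<lbrace>proj f, proj g\<rbrace>\<^bsub>Q\<^esub> = proj (witt_bracket f g)"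
proof -
  have eq: "proj (witt_bracket h l) = proj (witt_bracket f g)" if "h \<in> proj f" "l \<in> proj g" for h l
  proof -
    \<comment> \<open>Representatives are exchanged one at a time; antisymmetry moves each element
      of \<open>K\<close> into the first slot, the one covered by \<open>bracket\<close>.\<close>
    have "witt_bracket h l = witt_bracket (h - f) l + witt_bracket f l"
      using witt_bracket_add[of "h - f" f l] by simp
    moreover have "witt_bracket f l = witt_bracket f g - witt_bracket (l - g) f"
      using witt_bracket_add_right[of f g "l - g"] witt_bracket_antisym[of f "l - g"] by simp
    ultimately have "witt_bracket h l - witt_bracket f g
        = witt_bracket (h - f) l - witt_bracket (l - g) f" by simp
    also have "\<dots> \<in> K" using that by (intro diff[OF bracket bracket]) (auto simp: proj_def)
    finally show ?thesis by (simp add: proj_eq_iff)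
  qed
  have "\<lbrace>proj f, proj g\<rbrace>\<^bsub>Q\<^esub> = (\<Union>h\<in>proj f. \<Union>l\<in>proj g. proj (witt_bracket h l))"
    by (simp add: poisson_quot_def coset_eq_proj)
  also have "\<dots> = (\<Union>h\<in>proj f. \<Union>l\<in>proj g. proj (witt_bracket f g))"
    by (intro SUP_cong refl eq)
  also have "\<dots> = proj (witt_bracket f g)" using proj_self by auto
  finally show ?thesis .
qed

lemmas Q_simps = Q_add Q_mult Q_one Q_zero Q_smult Q_bracket

lemma module_Q: "Module.module class_ring Q"
  using poisson_quot_algebra[OF poisson_algebra_SW poisson_ideal]
  by (intro algebra.axioms poisson_algebra.axioms)

section \<open>Submodules, independence and dimension in the quotient\<close>

lemma vectorspace_Q: "vectorspace class_ring Q"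
  by (intro vectorspace.intro module_Q class_field)

lemma submodule_Q_iff:
  "LinearCombinations.submodule class_ring X Q \<longleftrightarrow> X \<subseteq> range proj \<and> proj 0 \<in> X \<and>
    (\<forall>x\<in>X. \<forall>y\<in>X. x \<oplus>\<^bsub>Q\<^esub> y \<in> X) \<and> (\<forall>c. \<forall>x\<in>X. c \<odot>\<^bsub>Q\<^esub> x \<in> X)"
  by (auto simp: LinearCombinations.submodule_def module_Q carrier_Q Q_zero)

lemma submodule_proj_image:
  assumes "subspace_poly U"
  shows "LinearCombinations.submodule class_ring (proj ` U) Q"
  using subspace_polyD[OF assms] by (auto simp: submodule_Q_iff Q_add Q_smult)

lemma subspace_poly_vimage:
  assumes "LinearCombinations.submodule class_ring X Q"
  shows "subspace_poly {f. proj f \<in> X}"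
  using assms by (auto simp: submodule_Q_iff subspace_poly_def Q_add[symmetric] Q_smult[symmetric])

lemma module_submodule:
  "LinearCombinations.submodule class_ring X Q \<Longrightarrow> Module.module class_ring (Q\<lparr>carrier := X\<rparr>)"
  by (rule module.submodule_is_module[OF module_Q])

lemma vectorspace_submodule:
  "LinearCombinations.submodule class_ring X Q \<Longrightarrow> vectorspace class_ring (Q\<lparr>carrier := X\<rparr>)"
  by (intro vectorspace.intro module_submodule class_field)

lemma submodule_trans:
  assumes "LinearCombinations.submodule class_ring Y Q"
    and "LinearCombinations.submodule class_ring X (Q\<lparr>carrier := Y\<rparr>)"
  shows "LinearCombinations.submodule class_ring X Q"
  using assms by (auto simp: LinearCombinations.submodule_def)

text \<open>Spans for \<open>PGKdim\<close> are formed inside a subalgebra \<open>Y\<close>.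
  Intersecting with \<open>Y\<close> turns a submodule of the quotient into one to which such spans
  can be compared.\<close>

lemma submodule_Int:
  assumes "LinearCombinations.submodule class_ring X Q" "LinearCombinations.submodule class_ring Y Q"
  shows "LinearCombinations.submodule class_ring (X \<inter> Y) (Q\<lparr>carrier := Y\<rparr>)"
  using assms module_submodule[OF assms(2)] by (auto simp: LinearCombinations.submodule_def)

lemma finsum_proj:
  assumes X: "LinearCombinations.submodule class_ring X Q" and "finite I"
    and "\<And>i. i \<in> I \<Longrightarrow> v i \<in> X \<and> v i = proj (u i)"
  shows "finsum (Q\<lparr>carrier := X\<rparr>) v I = proj (\<Sum>i\<in>I. u i)"
proof -
  interpret M: Module.module class_ring "Q\<lparr>carrier := X\<rparr>" by (rule module_submodule[OF X])
  show ?thesis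
    using assms(2,3)
  proof (induction I rule: finite_induct)
    case empty
    show ?case using M.finsum_empty[of v] by (simp add: Q_zero)
  next
    case (insert i I)
    have "v \<in> I \<rightarrow> X" "v i \<in> X" using insert.prems by blast+
    hence "finsum (Q\<lparr>carrier := X\<rparr>) v (insert i I) = v i \<oplus>\<^bsub>Q\<^esub> finsum (Q\<lparr>carrier := X\<rparr>) v I"
      using M.finsum_insert[OF insert.hyps, of v] by simp
    also have "finsum (Q\<lparr>carrier := X\<rparr>) v I = proj (\<Sum>i\<in>I. u i)"
      by (rule insert.IH) (rule insert.prems, simp)
    also have "v i = proj (u i)" using insert.prems by blast
    also have "proj (u i) \<oplus>\<^bsub>Q\<^esub> proj (\<Sum>i\<in>I. u i) = proj (\<Sum>i\<in>insert i I. u i)"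
      using insert.hyps by (simp add: Q_add)
    finally show ?case .
  qed
qed

lemma indep_mod_lift:
  assumes X: "LinearCombinations.submodule class_ring X Q" and B: "B \<subseteq> X" "finite B"
    and li: "\<not> module.lin_dep class_ring (Q\<lparr>carrier := X\<rparr>) B"
    and u: "\<And>b. b \<in> B \<Longrightarrow> proj (u b) = b"
  shows "indep_mod K B u"
  unfolding indep_mod_def
proof (intro conjI allI impI ballI, rule B(2), rule ccontr)
  interpret M: Module.module class_ring "Q\<lparr>carrier := X\<rparr>" by (rule module_submodule[OF X])
  fix c b assume c: "(\<Sum>b\<in>B. cst (c b) * u b) \<in> K" "b \<in> B" "c b \<noteq> 0"
  have sm: "c x \<odot>\<^bsub>Q\<^esub> x \<in> X \<and> c x \<odot>\<^bsub>Q\<^esub> x = proj (cst (c x) * u x)" if "x \<in> B" for x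
  proof
    show "c x \<odot>\<^bsub>Q\<^esub> x \<in> X" using X B(1) that by (auto simp: submodule_Q_iff)
    show "c x \<odot>\<^bsub>Q\<^esub> x = proj (cst (c x) * u x)" using Q_smult[of "c x" "u x"] u[OF that] by simp
  qed
  have "M.lincomb c B = finsum (Q\<lparr>carrier := X\<rparr>) (\<lambda>x. c x \<odot>\<^bsub>Q\<^esub> x) B"
    by (simp add: M.lincomb_def)
  also have "\<dots> = proj (\<Sum>b\<in>B. cst (c b) * u b)"
    by (rule finsum_proj[OF X B(2) sm])
  also have "\<dots> = proj 0" using c(1) by (simp add: proj_eq_iff)
  finally have "M.lin_dep B"
    by (intro M.lin_dep_crit[OF B(2) order_refl _ c(2)]) (use c(3) in \<open>auto simp: Q_zero\<close>)
  thus False using li by blast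
qed

text \<open>Finite dimension is not known in advance: a basis arises as a maximal independent set,
  which exists by the uniform bound \<open>N\<close>. Its lift into \<open>U\<close> is the set
  \<open>B\<close>.\<close>

lemma submodule_dim:
  assumes X: "LinearCombinations.submodule class_ring X Q" "X \<subseteq> proj ` U"
    and bound: "\<And>B. B \<subseteq> U \<Longrightarrow> indep_mod K B (\<lambda>x. x) \<Longrightarrow> card B \<le> N"
  shows "vectorspace.fin_dim class_ring (Q\<lparr>carrier := X\<rparr>)"
    and "\<exists>B\<subseteq>U. proj ` B \<subseteq> X \<and> indep_mod K B (\<lambda>x. x) \<and> card B = subspace_dim class_ring Q X"
proof -
  interpret V: vectorspace class_ring "Q\<lparr>carrier := X\<rparr>" by (rule vectorspace_submodule[OF X(1)])
  have lift: "\<exists>B'\<subseteq>U. proj ` B' \<subseteq> X \<and> indep_mod K B' (\<lambda>x. x) \<and> card B' = card B"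
    if B: "B \<subseteq> X" "finite B" "V.lin_indpt B" for B
  proof -
    have "\<forall>b\<in>B. \<exists>f. f \<in> U \<and> proj f = b" using B(1) X(2) by blast
    then obtain u where u: "\<forall>b\<in>B. u b \<in> U \<and> proj (u b) = b" by (rule bchoice[THEN exE])
    have "indep_mod K B u" by (rule indep_mod_lift[OF X(1) B]) (use u in blast)
    note im = indep_mod_image[OF subspace this]
    show ?thesis
      by (rule exI[of _ "u ` B"]) (use u B(1) im card_image[OF im(1)] in auto)
  qed
  have finbound: "finite B \<and> card B \<le> N" if B: "B \<subseteq> X \<and> V.lin_indpt B" for B
  proof -
    have *: "card B' \<le> N" if "B' \<subseteq> B" "finite B'" for B'
    proof -
      have "V.lin_indpt B'" using V.subset_li_is_li[of B B'] B that by auto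
      from lift[OF _ that(2) this] B that(1) show ?thesis using bound by (metis order_trans)
    qed
    have "finite B"
    proof (rule ccontr)
      assume "infinite B"
      then obtain B' where "finite B'" "card B' = Suc N" "B' \<subseteq> B"
        using infinite_arbitrarily_large by blast
      thus False using *[of B'] by simp
    qed
    thus ?thesis using * by blast
  qed
  have "\<exists>A. finite A \<and> maximal A (\<lambda>S. S \<subseteq> X \<and> V.lin_indpt S)"
  proof (rule maximal_exists[OF finbound])
    show "{} \<subseteq> X \<and> V.lin_indpt {}" by (simp add: V.lin_dep_def)
  qed
  then obtain A where A: "finite A" "maximal A (\<lambda>S. S \<subseteq> carrier (Q\<lparr>carrier := X\<rparr>) \<and> V.lin_indpt S)"
    by auto
  have basis: "V.basis A" by (rule V.max_li_is_basis[OF A(2)])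
  thus "V.fin_dim" using A(1) unfolding V.fin_dim_def V.basis_def by blast
  have "subspace_dim class_ring Q X = card A"
    unfolding subspace_dim_def by (rule V.dim_basis[OF A(1) basis])
  moreover have "A \<subseteq> X" "V.lin_indpt A" using basis unfolding V.basis_def by auto
  ultimately show "\<exists>B\<subseteq>U. proj ` B \<subseteq> X \<and> indep_mod K B (\<lambda>x. x) \<and> card B = subspace_dim class_ring Q X"
    using lift[of A] A(1) by simp
qed

text \<open>A coincidence or relation between images pulls back to a relation modulo
  \<open>K\<close>. Together with \<open>submodule_dim\<close> this translates dimensions into
  cardinalities of sets of polynomials.\<close>

lemma card_le_subspace_dim:
  assumes X: "LinearCombinations.submodule class_ring X Q" "vectorspace.fin_dim class_ring (Q\<lparr>carrier := X\<rparr>)"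
    and C: "indep_mod K C (\<lambda>x. x)" "proj ` C \<subseteq> X"
  shows "card C \<le> subspace_dim class_ring Q X"
proof -
  interpret V: vectorspace class_ring "Q\<lparr>carrier := X\<rparr>" by (rule vectorspace_submodule[OF X(1)])
  have fin: "finite C" using C(1) by (simp add: indep_mod_def)
  have inj: "inj_on proj C"
  proof (rule inj_onI, rule ccontr)
    fix x y assume xy: "x \<in> C" "y \<in> C" "proj x = proj y" "x \<noteq> y"
    let ?c = "\<lambda>l. (if l = x then 1 else 0) - (if l = y then 1 else 0) :: 'k"
    have "(\<Sum>l\<in>C. cst (?c l) * l) = (\<Sum>l\<in>C. (if l = x then l else 0) - (if l = y then l else 0))"
      by (intro sum.cong refl) (auto simp: single_diff)
    also have "\<dots> = x - y" using fin xy by (simp add: sum_subtractf sum.delta)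
    finally have "?c x = 0"
      using indep_modD[OF C(1), of ?c x] xy by (simp add: proj_eq_iff)
    thus False using xy(4) by simp
  qed
  have "V.lin_indpt (proj ` C)"
  proof (rule V.finite_lin_indpt2)
    fix a assume a: "V.lincomb a (proj ` C) = \<zero>\<^bsub>Q\<lparr>carrier := X\<rparr>\<^esub>"
    let ?u = "\<lambda>v. cst (a v) * inv_into C proj v"
    have sm: "a v \<odot>\<^bsub>Q\<^esub> v \<in> X \<and> a v \<odot>\<^bsub>Q\<^esub> v = proj (?u v)" if "v \<in> proj ` C" for v
    proof
      show "a v \<odot>\<^bsub>Q\<^esub> v \<in> X" using X(1) C(2) that by (auto simp: submodule_Q_iff)
      show "a v \<odot>\<^bsub>Q\<^esub> v = proj (?u v)"
        using Q_smult[of "a v" "inv_into C proj v"] by (simp add: f_inv_into_f[OF that])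
    qed
    have "V.lincomb a (proj ` C) = finsum (Q\<lparr>carrier := X\<rparr>) (\<lambda>v. a v \<odot>\<^bsub>Q\<^esub> v) (proj ` C)"
      by (simp add: V.lincomb_def)
    also have "\<dots> = proj (\<Sum>v\<in>proj ` C. ?u v)"
      by (rule finsum_proj[OF X(1) finite_imageI[OF fin] sm])
    also have "(\<Sum>v\<in>proj ` C. ?u v) = (\<Sum>x\<in>C. cst (a (proj x)) * x)"
      by (simp add: sum.reindex[OF inj] inv_into_f_f[OF inj])
    finally have "proj (\<Sum>x\<in>C. cst (a (proj x)) * x) = proj 0"
      using a by (simp add: Q_zero)
    hence "(\<Sum>x\<in>C. cst (a (proj x)) * x) \<in> K"
      by (simp only: proj_eq_iff diff_zero)
    from indep_modD[OF C(1) this] show "\<forall>v\<in>proj ` C. a v = \<zero>\<^bsub>class_ring\<^esub>" by auto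
  qed (use fin C(2) in auto)
  from V.li_le_dim(2)[OF X(2) _ this] C(2) show ?thesis
    by (simp add: subspace_dim_def card_image[OF inj])
qed

section \<open>Powers of subspaces\<close>

lemma span_subset:
  assumes "LinearCombinations.submodule class_ring Y Q"
    and "LinearCombinations.submodule class_ring N (Q\<lparr>carrier := Y\<rparr>)" "S \<subseteq> N"
  shows "LinearCombinations.module.span class_ring (Q\<lparr>carrier := Y\<rparr>) S \<subseteq> N"
  by (rule module.span_is_subset[OF module_submodule[OF assms(1)] assms(3,2)])

lemma wle_cover: "\<exists>n. f \<in> wle n"
proof
  show "f \<in> wle (\<Sum>m\<in>Poly_Mapping.keys f. wdeg Suc m)"
    by (auto simp: wle_def polys_on_def intro!: member_le_sum)
qed

lemma fin_dim_subset_wle: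
  assumes V: "LinearCombinations.submodule class_ring V Q"
    "vectorspace.fin_dim class_ring (Q\<lparr>carrier := V\<rparr>)"
  shows "\<exists>c\<ge>1. V \<subseteq> proj ` wle c"
proof -
  interpret V: vectorspace class_ring "Q\<lparr>carrier := V\<rparr>" by (rule vectorspace_submodule[OF V(1)])
  obtain A where A: "finite A" "A \<subseteq> V" "V.span A = V"
    using V(2) unfolding V.fin_dim_def by auto
  have "\<forall>a\<in>A. \<exists>n. a \<in> proj ` wle n"
  proof
    fix a assume "a \<in> A"
    then obtain f where "a = proj f" using A(2) V(1) by (auto simp: submodule_Q_iff)
    thus "\<exists>n. a \<in> proj ` wle n" using wle_cover[of f] by auto
  qed
  then obtain n where n: "\<forall>a\<in>A. a \<in> proj ` wle (n a)" by (rule bchoice[THEN exE])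
  \<comment> \<open>The sum bounds every \<open>n a\<close>, and \<open>Suc\<close> secures
    \<open>c \<ge> 1\<close>, as rescaling requires.\<close>
  define c where "c = Suc (\<Sum>a\<in>A. n a)"
  have "A \<subseteq> proj ` wle c \<inter> V"
  proof
    fix a assume a: "a \<in> A"
    have "n a \<le> c" unfolding c_def using member_le_sum[OF a, of n] A(1) by simp
    hence "proj ` wle (n a) \<subseteq> proj ` wle c" by (intro image_mono wle_mono)
    from subsetD[OF this bspec[OF n a]] subsetD[OF A(2) a]
    show "a \<in> proj ` wle c \<inter> V" by (rule IntI)
  qed
  from span_subset[OF V(1) submodule_Int[OF submodule_proj_image[OF subspace_wle] V(1)] this]
  have "V \<subseteq> proj ` wle c" by (simp add: A(3))
  thus ?thesis by (intro exI[of _ c]) (simp add: c_def)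
qed

lemma poisson_subalgebra_submodule:
  "poisson_subalgebra class_ring Y Q \<Longrightarrow> LinearCombinations.submodule class_ring Y Q"
  by (simp add: poisson_subalgebra_def VectorSpace.subspace_def)

lemma poisson_subalgebra_carrier: "poisson_subalgebra class_ring (carrier Q) Q"
  by (auto simp: poisson_subalgebra_def VectorSpace.subspace_def vectorspace_Q submodule_Q_iff
      carrier_Q Q_simps)

text \<open>Each step multiplies or brackets with an element of weight at most \<open>c\<close>, and
  both operations add weights.\<close>

lemma poisson_power_subset:
  assumes Y: "poisson_subalgebra class_ring Y Q" and V: "V \<subseteq> proj ` wle c" "V \<subseteq> Y"
  shows "poisson_power class_ring (Q\<lparr>carrier := Y\<rparr>) V k \<subseteq> proj ` wle (c * k) \<inter> Y"
proof -
  note sub = poisson_subalgebra_submodule[OF Y]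
  note N = submodule_Int[OF submodule_proj_image[OF subspace_wle] sub]
  show ?thesis
  proof (induction k)
    case 0
    have "{\<one>\<^bsub>Q\<^esub>} \<subseteq> proj ` wle (c * 0) \<inter> Y"
      using Y cst_wle[of 1 "c * 0"] by (auto simp: poisson_subalgebra_def Q_one)
    from span_subset[OF sub N this] show ?case by simp
  next
    case (Suc k)
    let ?P = "poisson_power class_ring (Q\<lparr>carrier := Y\<rparr>) V k"
    have *: "x \<otimes>\<^bsub>Q\<^esub> y \<in> proj ` wle (c * Suc k) \<inter> Y \<and> \<lbrace>x, y\<rbrace>\<^bsub>Q\<^esub> \<in> proj ` wle (c * Suc k) \<inter> Y"
      if xy: "x \<in> V" "y \<in> ?P" for x y
    proof -
      obtain f g where fg: "f \<in> wle c" "x = proj f" "g \<in> wle (c * k)" "y = proj g"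
        using xy V(1) Suc by blast
      have "x \<in> Y" "y \<in> Y" using xy V(2) Suc by auto
      moreover have "f * g \<in> wle (c * Suc k)" "witt_bracket f g \<in> wle (c * Suc k)"
        using wle_mult[OF fg(1,3)] witt_bracket_wle[OF fg(1,3)] by simp_all
      moreover from calculation(1,2) have "x \<otimes>\<^bsub>Q\<^esub> y \<in> Y" "\<lbrace>x, y\<rbrace>\<^bsub>Q\<^esub> \<in> Y"
        using Y by (auto simp: poisson_subalgebra_def)
      ultimately show ?thesis
        unfolding fg(2,4) Q_mult Q_bracket by blast
    qed
    have mult_sub: "span_mult class_ring (Q\<lparr>carrier := Y\<rparr>) V ?P \<subseteq> proj ` wle (c * Suc k) \<inter> Y"
      unfolding span_mult_def by (rule span_subset[OF sub N]) (use * in auto)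
    have bracket_sub: "span_bracket class_ring (Q\<lparr>carrier := Y\<rparr>) V ?P \<subseteq> proj ` wle (c * Suc k) \<inter> Y"
      unfolding span_bracket_def by (rule span_subset[OF sub N]) (use * in auto)
    have add_closed: "x \<oplus>\<^bsub>Q\<^esub> y \<in> proj ` wle (c * Suc k) \<inter> Y"
      if "x \<in> proj ` wle (c * Suc k) \<inter> Y" "y \<in> proj ` wle (c * Suc k) \<inter> Y" for x y
      using submodule_proj_image[OF subspace_wle, of "c * Suc k"] sub that
      by (auto simp: submodule_Q_iff)
    show ?case
    proof
      fix z assume "z \<in> poisson_power class_ring (Q\<lparr>carrier := Y\<rparr>) V (Suc k)"
      then obtain x y where z: "z = x \<oplus>\<^bsub>Q\<^esub> y"
        and x: "x \<in> span_mult class_ring (Q\<lparr>carrier := Y\<rparr>) V ?P"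
        and y: "y \<in> span_bracket class_ring (Q\<lparr>carrier := Y\<rparr>) V ?P"
        by (auto simp: module.submodule_sum_def[OF module_submodule[OF sub]])
      show "z \<in> proj ` wle (c * Suc k) \<inter> Y"
        unfolding z by (rule add_closed[OF subsetD[OF mult_sub x] subsetD[OF bracket_sub y]])
    qed
  qed
qed

lemma update_carrier_Q: "Q\<lparr>carrier := carrier Q\<rparr> = Q"
  by simp

text \<open>The products form one summand of the Poisson power; adding the zero of the bracket span
  places them in the sum.\<close>

lemma subspace_power_subset_poisson_power:
  assumes "V \<subseteq> carrier Q"
  shows "subspace_power class_ring Q V k \<subseteq> poisson_power class_ring Q V k"
    and "poisson_power class_ring Q V k \<subseteq> carrier Q"
proof -
  interpret M: Module.module class_ring Q by (rule module_Q)
  have closed: "x \<otimes>\<^bsub>Q\<^esub> y \<in> carrier Q" "\<lbrace>x, y\<rbrace>\<^bsub>Q\<^esub> \<in> carrier Q" if "x \<in> carrier Q" "y \<in> carrier Q" for x y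
    using poisson_subalgebra_carrier that by (auto simp: poisson_subalgebra_def)
  have one: "\<one>\<^bsub>Q\<^esub> \<in> carrier Q" by (simp add: Q_one carrier_Q)
  show carr: "poisson_power class_ring Q V k \<subseteq> carrier Q" for k
  proof (induction k)
    case 0
    show ?case using one by (auto intro!: M.span_is_subset2)
  next
    case (Suc k)
    have "span_mult class_ring Q V (poisson_power class_ring Q V k) \<subseteq> carrier Q"
      unfolding span_mult_def by (rule M.span_is_subset2) (use Suc assms in \<open>auto intro: closed\<close>)
    moreover have "span_bracket class_ring Q V (poisson_power class_ring Q V k) \<subseteq> carrier Q"
      unfolding span_bracket_def by (rule M.span_is_subset2) (use Suc assms in \<open>auto intro: closed\<close>)
    ultimately show ?case by (auto simp: M.submodule_sum_def)
  qed
  show "subspace_power class_ring Q V k \<subseteq> poisson_power class_ring Q V k"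
  proof (induction k)
    case (Suc k)
    let ?P = "poisson_power class_ring Q V k"
    have "span_mult class_ring Q V (subspace_power class_ring Q V k) \<subseteq> span_mult class_ring Q V ?P"
      unfolding span_mult_def by (rule M.span_is_monotone) (use Suc in blast)
    also have "\<dots> \<subseteq> M.submodule_sum (span_mult class_ring Q V ?P) (span_bracket class_ring Q V ?P)"
    proof
      fix x assume x: "x \<in> span_mult class_ring Q V ?P"
      have "span_mult class_ring Q V ?P \<subseteq> carrier Q"
        unfolding span_mult_def
        using carr[of k] assms by (intro M.span_is_subset2) (auto intro: closed)
      hence "x \<oplus>\<^bsub>Q\<^esub> \<zero>\<^bsub>Q\<^esub> = x" using x by auto
      moreover have "\<zero>\<^bsub>Q\<^esub> \<in> span_bracket class_ring Q V ?P"
        unfolding span_bracket_def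
        using carr[of k] assms
        by (intro LinearCombinations.submodule.zero_closed[OF M.span_is_submodule]) (auto intro: closed)
      ultimately show "x \<in> M.submodule_sum (span_mult class_ring Q V ?P) (span_bracket class_ring Q V ?P)"
        using x unfolding M.submodule_sum_def by force
    qed
    finally show ?case by simp
  qed simp
qed

text \<open>\<open>W\<close> is spanned by the images of 1 and the first \<open>M\<close> variables.
  A monomial of degree at most \<open>k\<close> is a product of \<open>k\<close> such elements,
  padded by 1.\<close>

lemma subspace_power_box:
  assumes M: "W = proj ` box M 1"
  shows "subspace_power class_ring Q W k \<subseteq> proj ` box M k"
    and "proj ` box M k \<subseteq> subspace_power class_ring Q W k"
proof -
  interpret M: Module.module class_ring Q by (rule module_Q)
  note span_sub = M.span_is_subset[OF _ submodule_proj_image[OF subspace_box]]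
  show sub: "subspace_power class_ring Q W k \<subseteq> proj ` box M k" for k
  proof (induction k)
    case 0
    have "{\<one>\<^bsub>Q\<^esub>} \<subseteq> proj ` box M 0" using imageI[OF one_box[of M 0], of proj] by (simp add: Q_one)
    from span_sub[OF this] show ?case by simp
  next
    case (Suc k)
    have "{u \<otimes>\<^bsub>Q\<^esub> w |u w. u \<in> W \<and> w \<in> subspace_power class_ring Q W k} \<subseteq> proj ` box M (Suc k)"
    proof safe
      fix u w assume "u \<in> W" "w \<in> subspace_power class_ring Q W k"
      then obtain f g where "f \<in> box M 1" "u = proj f" "g \<in> box M k" "w = proj g"
        using Suc M by blast
      thus "u \<otimes>\<^bsub>Q\<^esub> w \<in> proj ` box M (Suc k)"
        using box_mult[of f M 1 g k] by (simp add: Q_mult)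
    qed
    from span_sub[OF this] show ?case by (simp add: span_mult_def)
  qed
  have W: "W \<subseteq> carrier Q" by (auto simp: M carrier_Q)
  have P_carr: "subspace_power class_ring Q W k \<subseteq> carrier Q" for k
    using sub[of k] by (auto simp: carrier_Q)
  have closed: "x \<otimes>\<^bsub>Q\<^esub> y \<in> carrier Q" if "x \<in> carrier Q" "y \<in> carrier Q" for x y
    using poisson_subalgebra_carrier that by (auto simp: poisson_subalgebra_def)
  have prod: "proj (f * g) \<in> subspace_power class_ring Q W (Suc k)"
    if "f \<in> box M 1" "proj g \<in> subspace_power class_ring Q W k" for f g k
  proof -
    have "{u \<otimes>\<^bsub>Q\<^esub> w |u w. u \<in> W \<and> w \<in> subspace_power class_ring Q W k} \<subseteq> carrier Q"
      using W P_carr[of k] by (auto intro: closed)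
    from M.in_own_span[OF this] show ?thesis
      using that by (auto simp: span_mult_def M Q_mult[symmetric])
  qed
  have submod: "LinearCombinations.submodule class_ring (subspace_power class_ring Q W k) Q" for k
  proof (cases k)
    case 0
    show ?thesis unfolding 0 subspace_power.simps
      by (rule M.span_is_submodule) (simp add: Q_one carrier_Q)
  next
    case (Suc l)
    show ?thesis unfolding Suc subspace_power.simps span_mult_def
      by (rule M.span_is_submodule) (use W P_carr[of l] in \<open>auto intro: closed\<close>)
  qed
  have mon: "proj (Poly_Mapping.single m 1) \<in> subspace_power class_ring Q W k"
    if "Poly_Mapping.keys m \<subseteq> {..<M}" "wdeg (\<lambda>_. 1) m \<le> k" for m
    using that
  proof (induction k arbitrary: m)
    case 0
    have "Poly_Mapping.keys m = {}" using 0(2) wdeg_ge[of _ m "\<lambda>_. 1"] by force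
    hence "m = 0" by simp
    thus ?case
      using M.in_own_span[of "{\<one>\<^bsub>Q\<^esub>}"] by (simp add: Q_one carrier_Q)
  next
    case (Suc k)
    show ?case
    proof (cases "Poly_Mapping.keys m = {}")
      case True
      hence "m = 0" by simp
      thus ?thesis using prod[OF one_box[of M 1] Suc.IH[of 0]] by (simp add: wdeg_zero)
    next
      case False
      then obtain i where i: "i \<in> Poly_Mapping.keys m" by blast
      define m' where "m' = m - Poly_Mapping.single i 1"
      have m: "m = Poly_Mapping.single i 1 + m'"
        using i unfolding m'_def by (intro poly_mapping_eqI)
          (auto simp: lookup_add lookup_minus lookup_single when_def in_keys_iff)
      have "Poly_Mapping.keys m' \<subseteq> Poly_Mapping.keys m"
        by (auto simp: m'_def in_keys_iff lookup_minus)
      moreover have "wdeg (\<lambda>_. 1) m' \<le> k"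
        using Suc.prems(2) unfolding m wdeg_add wdeg_single by simp
      ultimately have "proj (Poly_Mapping.single m' 1) \<in> subspace_power class_ring Q W k"
        using Suc.prems(1) by (intro Suc.IH) auto
      moreover have "i < M" using i Suc.prems(1) by auto
      ultimately show ?thesis
        using prod[OF var_box[of i M 1]] unfolding m monomial_Suc by simp
    qed
  qed
  have "box M k \<subseteq> {f. proj f \<in> subspace_power class_ring Q W k}"
    unfolding box_def
    by (rule polys_on_subset_subspace[OF subspace_poly_vimage[OF submod]]) (use mon in auto)
  thus "proj ` box M k \<subseteq> subspace_power class_ring Q W k" by auto
qed

section \<open>Comparison of the two dimensions\<close>

lemma card_indep_box:
  assumes "indep_mod K B (\<lambda>x. x)" "B \<subseteq> box M D"
  shows "card B \<le> (D + 1) ^ M"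
proof -
  have "card B \<le> card (monomials M D)"
    using indep_mod_card_le[OF assms(1) _ zero card_monomials(1)] assms(2) by (simp add: box_eq_polys_on)
  also have "\<dots> \<le> (D + 1) ^ M" by (rule card_monomials)
  finally show ?thesis .
qed

lemma fin_dim_proj_box:
  assumes "LinearCombinations.submodule class_ring X Q" "X \<subseteq> proj ` box M D"
  shows "vectorspace.fin_dim class_ring (Q\<lparr>carrier := X\<rparr>)" and "subspace_dim class_ring Q X \<le> (D + 1) ^ M"
proof -
  note * = submodule_dim[OF assms(1,2) card_indep_box[of _ M D]]
  show "vectorspace.fin_dim class_ring (Q\<lparr>carrier := X\<rparr>)" by (rule *(1))
  show "subspace_dim class_ring Q X \<le> (D + 1) ^ M" using *(2) card_indep_box by metis
qed

text \<open>A basis of \<open>X\<close> lifts to polynomials with independent images in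
  \<open>Y\<close>; the box makes both spaces finite-dimensional.\<close>

lemma subspace_dim_mono:
  assumes X: "LinearCombinations.submodule class_ring X Q"
    and Y: "LinearCombinations.submodule class_ring Y Q" "Y \<subseteq> proj ` box M D" and "X \<subseteq> Y"
  shows "subspace_dim class_ring Q X \<le> subspace_dim class_ring Q Y"
proof -
  have "X \<subseteq> proj ` box M D" using assms(3,4) by blast
  from submodule_dim(2)[OF X this card_indep_box[of _ M D]]
  obtain B where "proj ` B \<subseteq> X" "indep_mod K B (\<lambda>x. x)" "card B = subspace_dim class_ring Q X"
    by blast
  with card_le_subspace_dim[OF Y(1) fin_dim_proj_box(1)[OF Y], of B] assms(4) show ?thesis by auto
qed

lemma span_subspace_power_box:
  "LinearCombinations.module.span class_ring Q (\<Union>k\<le>n. subspace_power class_ring Q (proj ` box M 1) k)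
    = proj ` box M n"
proof (rule equalityI)
  have sub: "subspace_power class_ring Q (proj ` box M 1) k \<subseteq> proj ` box M n" if "k \<le> n" for k
    using subspace_power_box(1)[OF refl, of M k] image_mono[OF box_mono[OF order_refl that, of M], of proj]
    by (rule order_trans)
  hence sub': "(\<Union>k\<le>n. subspace_power class_ring Q (proj ` box M 1) k) \<subseteq> proj ` box M n" by blast
  show "LinearCombinations.module.span class_ring Q (\<Union>k\<le>n. subspace_power class_ring Q (proj ` box M 1) k)
      \<subseteq> proj ` box M n"
    by (rule module.span_is_subset[OF module_Q sub' submodule_proj_image[OF subspace_box]])
  have "proj ` box M n \<subseteq> (\<Union>k\<le>n. subspace_power class_ring Q (proj ` box M 1) k)"
    using subspace_power_box(2)[OF refl, of M n] by blast
  also have "\<dots> \<subseteq> LinearCombinations.module.span class_ring Q (\<Union>k\<le>n. subspace_power class_ring Q (proj ` box M 1) k)"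
    by (rule module.in_own_span[OF module_Q]) (use sub' in \<open>auto simp: carrier_Q\<close>)
  finally show "proj ` box M n \<subseteq> LinearCombinations.module.span class_ring Q
      (\<Union>k\<le>n. subspace_power class_ring Q (proj ` box M 1) k)" .
qed

lemma span_poisson_power:
  assumes Y: "poisson_subalgebra class_ring Y Q" and V: "V \<subseteq> proj ` wle c" "V \<subseteq> Y"
  defines "X \<equiv> \<lambda>n. LinearCombinations.module.span class_ring (Q\<lparr>carrier := Y\<rparr>)
    (\<Union>k\<le>n. poisson_power class_ring (Q\<lparr>carrier := Y\<rparr>) V k)"
  shows "LinearCombinations.submodule class_ring (X n) Q" and "X n \<subseteq> proj ` wle (c * n)"
    and "pd class_ring (Q\<lparr>carrier := Y\<rparr>) V n = subspace_dim class_ring Q (X n)"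
proof -
  note sub = poisson_subalgebra_submodule[OF Y]
  have "poisson_power class_ring (Q\<lparr>carrier := Y\<rparr>) V k \<subseteq> proj ` wle (c * n) \<inter> Y" if "k \<le> n" for k
  proof -
    have "proj ` wle (c * k) \<subseteq> proj ` wle (c * n)"
      using that by (intro image_mono wle_mono mult_le_mono2)
    thus ?thesis using poisson_power_subset[OF Y V, of k] by blast
  qed
  hence *: "(\<Union>k\<le>n. poisson_power class_ring (Q\<lparr>carrier := Y\<rparr>) V k) \<subseteq> proj ` wle (c * n) \<inter> Y"
    by blast
  show "X n \<subseteq> proj ` wle (c * n)"
    using span_subset[OF sub submodule_Int[OF submodule_proj_image[OF subspace_wle] sub] *]
    unfolding X_def by blast
  show "LinearCombinations.submodule class_ring (X n) Q"
    unfolding X_def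
    by (intro submodule_trans[OF sub] module.span_is_submodule[OF module_submodule[OF sub]])
      (use * in auto)
  show "pd class_ring (Q\<lparr>carrier := Y\<rparr>) V n = subspace_dim class_ring Q (X n)"
    by (simp add: pd_def X_def subspace_dim_def)
qed

text \<open>Poisson powers up to \<open>n\<close> lift to weight at most \<open>c * n\<close>, and
  domination bounds their dimension by \<open>s\<close> times that of the box of degree
  \<open>C * (c * n)\<close>. Neither the factor nor the rescaling raises the growth
  exponent.\<close>

lemma pd_growth_le:
  assumes dom: "dominated K M s C" "C \<ge> 1" and Y: "poisson_subalgebra class_ring Y Q"
    and V: "fin_dim_subspace class_ring V (Q\<lparr>carrier := Y\<rparr>)"
  shows "growth_exponent (pd class_ring (Q\<lparr>carrier := Y\<rparr>) V)
    \<le> growth_exponent (\<lambda>n. subspace_dim class_ring Q (proj ` box M n))"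
proof -
  note sub = poisson_subalgebra_submodule[OF Y]
  have V': "LinearCombinations.submodule class_ring V (Q\<lparr>carrier := Y\<rparr>)"
    "vectorspace.fin_dim class_ring (Q\<lparr>carrier := V\<rparr>)"
    using V by (auto simp: fin_dim_subspace_def VectorSpace.subspace_def)
  obtain c where c: "c \<ge> 1" "V \<subseteq> proj ` wle c"
    using fin_dim_subset_wle[OF submodule_trans[OF sub V'(1)] V'(2)] by blast
  have "V \<subseteq> Y" using V'(1) by (auto simp: LinearCombinations.submodule_def)
  note X = span_poisson_power[OF Y c(2) this]
  show ?thesis
  proof (rule growth_exponent_le)
    show "C * c \<ge> 1" using dom(2) c(1) by simp
    fix n :: nat
    have bound: "card B \<le> (c * n + 1) ^ (c * n)" if "B \<subseteq> wle (c * n)" "indep_mod K B (\<lambda>x. x)" for B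
      using card_indep_box[OF that(2)] that(1) wle_subset_box by blast
    obtain B where B: "B \<subseteq> wle (c * n)" "indep_mod K B (\<lambda>x. x)"
        "card B = pd class_ring (Q\<lparr>carrier := Y\<rparr>) V n"
      using submodule_dim(2)[OF X(1,2) bound] unfolding X(3) by blast
    obtain D where D: "D \<subseteq> box M (C * (c * n))" "indep_mod K D (\<lambda>x. x)" "card B \<le> s * card D"
      using dom(1) B(1,2) unfolding dominated_def by metis
    note box = submodule_proj_image[OF subspace_box, of M "C * c * n"]
    have "card D \<le> subspace_dim class_ring Q (proj ` box M (C * c * n))"
      by (rule card_le_subspace_dim[OF box fin_dim_proj_box(1)[OF box order_refl] D(2)])
        (use D(1) in \<open>auto simp: mult.assoc\<close>)
    hence "s * card D \<le> s * subspace_dim class_ring Q (proj ` box M (C * c * n))"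
      by (rule mult_le_mono2)
    with D(3) show "pd class_ring (Q\<lparr>carrier := Y\<rparr>) V n
        \<le> s * subspace_dim class_ring Q (proj ` box M (C * c * n))"
      unfolding B(3) by (rule order_trans)
  qed
qed

lemma power_growth_le_pd_growth:
  assumes V: "fin_dim_subspace class_ring V Q"
  shows "growth_exponent (\<lambda>n. subspace_dim class_ring Q (LinearCombinations.module.span class_ring Q
      (\<Union>k\<le>n. subspace_power class_ring Q V k))) \<le> growth_exponent (pd class_ring Q V)"
proof -
  interpret M: Module.module class_ring Q by (rule module_Q)
  have V': "LinearCombinations.submodule class_ring V Q" "vectorspace.fin_dim class_ring (Q\<lparr>carrier := V\<rparr>)"
    using V by (auto simp: fin_dim_subspace_def VectorSpace.subspace_def)
  obtain c where c: "c \<ge> 1" "V \<subseteq> proj ` wle c" using fin_dim_subset_wle[OF V'] by blast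
  have carr: "V \<subseteq> carrier Q" using V'(1) by (auto simp: LinearCombinations.submodule_def)
  note X = span_poisson_power[OF poisson_subalgebra_carrier c(2) carr, unfolded update_carrier_Q]
  note pow = subspace_power_subset_poisson_power[OF carr]
  show ?thesis
  proof (rule growth_exponent_le[of 1 _ 1])
    fix n :: nat
    have "proj ` wle (c * n) \<subseteq> proj ` box (c * n) (c * n)" by (intro image_mono wle_subset_box)
    with X(2)[of n] have box: "M.span (\<Union>k\<le>n. poisson_power class_ring Q V k) \<subseteq> proj ` box (c * n) (c * n)"
      by (rule order_trans)
    have "(\<Union>k\<le>n. subspace_power class_ring Q V k) \<subseteq> (\<Union>k\<le>n. poisson_power class_ring Q V k)"
      by (intro UN_mono order_refl pow(1))
    moreover have "(\<Union>k\<le>n. subspace_power class_ring Q V k) \<subseteq> carrier Q"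
      using pow by blast
    ultimately show "subspace_dim class_ring Q (M.span (\<Union>k\<le>n. subspace_power class_ring Q V k))
        \<le> 1 * pd class_ring Q V (1 * n)"
      using subspace_dim_mono[OF M.span_is_submodule X(1)[of n] box M.span_is_monotone]
      by (simp add: X(3))
  qed simp
qed

lemma fin_dim_subspace_proj_box: "fin_dim_subspace class_ring (proj ` box M D) Q"
  using fin_dim_proj_box(1)[OF submodule_proj_image[OF subspace_box] order_refl]
  by (simp add: fin_dim_subspace_def VectorSpace.subspace_def vectorspace_Q
      submodule_proj_image subspace_box)

text \<open>In characteristic zero \<open>x_1\<close> and \<open>x_2\<close> generate all variables,
  since \<open>{x_1, x_j} = (j - 1) x_(j+1)\<close> has a nonzero coefficient for
  \<open>j \<ge> 2\<close>.\<close>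

lemma poisson_generates_proj_box:
  assumes "M \<ge> 2"
  shows "poisson_generates class_ring Q (proj ` box M 1)"
proof -
  have "proj f \<in> Y" if Y: "poisson_subalgebra class_ring Y Q" "proj ` box M 1 \<subseteq> Y" for Y f
  proof -
    note sub = subspace_polyD[OF subspace_poly_vimage[OF poisson_subalgebra_submodule[OF Y(1)]]]
    have closed: "proj (g * h) \<in> Y" "proj (witt_bracket g h) \<in> Y" if "proj g \<in> Y" "proj h \<in> Y" for g h
      using Y(1) that by (auto simp: poisson_subalgebra_def Q_mult[symmetric] Q_bracket[symmetric])
    have gen: "proj g \<in> Y" if "g \<in> box M 1" for g using Y(2) that by blast
    have var: "proj (var i) \<in> Y" for i
    proof (induction i rule: less_induct)
      case (less i)
      show ?case
      proof (cases "i < 2")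
        case True
        thus ?thesis using assms by (intro gen var_box) auto
      next
        case False
        then obtain j where j: "i = Suc j" "j \<ge> 1" by (cases i) auto
        have b: "witt_bracket (var 0) (var j) = cst (of_int (int j)) * (var i :: 'k infpoly)"
          using witt_bracket_xvar[of 1 "j + 1", where ?'k = 'k] j by (simp add: of_int_eq_cst)
        have "proj (witt_bracket (var 0) (var j)) \<in> Y"
          using assms j less.IH[of j] gen[OF var_box[of 0 M 1]] by (intro closed) auto
        hence "proj (cst (inverse (of_int (int j))) * (cst (of_int (int j)) * var i)) \<in> Y"
          unfolding b using sub(3) by blast
        moreover have "cst (inverse (of_int (int j))) * (cst (of_int (int j)) * var i) = (var i :: 'k infpoly)"
          using j(2) unfolding mult.assoc[symmetric] cst_mult[symmetric] by simp
        ultimately show ?thesis by (simp only:)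
      qed
    qed
    show ?thesis
    proof (induction f rule: infpoly_induct)
      case (const c)
      show ?case by (rule gen[OF cst_box])
    next
      case (add f g)
      thus ?case using sub(2) by blast
    qed (use var closed in auto)
  qed
  moreover have "proj ` box M 1 \<subseteq> carrier Q" by (auto simp: carrier_Q)
  ultimately show ?thesis
    using poisson_subalgebra_carrier unfolding poisson_generates_def by (auto simp: carrier_Q)
qed

text \<open>By \<open>pd_growth_le\<close> both suprema are at most \<open>d\<close>. The image of
  \<open>box M 1\<close> attains \<open>d\<close> with its ordinary powers, and its Poisson powers
  grow at least as fast.\<close>

lemma GKdim_PGKdim:
  assumes dom: "dominated K M s C" "C \<ge> 1" "M \<ge> 2"
  defines "d \<equiv> growth_exponent (\<lambda>n. subspace_dim class_ring Q (proj ` box M n))"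
  shows "GKdim class_ring Q = d" "PGKdim class_ring Q = d" "d < \<infinity>"
proof -
  let ?W = "proj ` box M 1"
  note W = fin_dim_subspace_proj_box[of M 1]
  note carr = poisson_subalgebra_carrier
  have gk_le: "growth_exponent (\<lambda>n. subspace_dim class_ring Q (LinearCombinations.module.span class_ring Q
      (\<Union>k\<le>n. subspace_power class_ring Q V k))) \<le> d" if "fin_dim_subspace class_ring V Q" for V
    using power_growth_le_pd_growth[OF that]
      pd_growth_le[OF dom(1,2) carr, unfolded update_carrier_Q, OF that]
    unfolding d_def by (rule order_trans)
  show "GKdim class_ring Q = d"
  proof (rule antisym)
    show "GKdim class_ring Q \<le> d" unfolding GKdim_def by (rule SUP_least) (use gk_le in blast)
    show "d \<le> GKdim class_ring Q" unfolding GKdim_def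
      by (rule SUP_upper2[of ?W]) (simp_all only: W span_subspace_power_box d_def mem_Collect_eq order_refl)
  qed
  show "PGKdim class_ring Q = d"
  proof (rule antisym)
    show "PGKdim class_ring Q \<le> d"
      unfolding PGKdim_def PGKdim_fg_def d_def
      by (intro SUP_least) (use pd_growth_le[OF dom(1,2)] in blast)
    have "d \<le> growth_exponent (pd class_ring Q ?W)"
      using power_growth_le_pd_growth[OF W] by (simp only: span_subspace_power_box d_def)
    also have "\<dots> \<le> PGKdim_fg class_ring Q"
      unfolding PGKdim_fg_def
      by (rule SUP_upper) (use W poisson_generates_proj_box[OF dom(3)] in blast)
    also have "\<dots> \<le> PGKdim class_ring Q"
      unfolding PGKdim_def
      by (rule SUP_upper2[of "carrier Q"])
        (use carr W poisson_generates_proj_box[OF dom(3)] in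
          \<open>simp_all only: poisson_fin_gen_def update_carrier_Q mem_Collect_eq, blast+\<close>)
    finally show "d \<le> PGKdim class_ring Q" .
  qed
  show "d < \<infinity>"
    unfolding d_def
    by (rule growth_exponent_polynomial)
      (rule fin_dim_proj_box(2)[OF submodule_proj_image[OF subspace_box] order_refl])
qed

end

theorem theorem1p6:
  fixes K :: "'k::field_char_0 infpoly set"
  assumes "poisson_ideal K SW" and "radical_ideal K SW" and "K \<noteq> {\<zero>\<^bsub>SW\<^esub>}"
  shows "PGKdim class_ring (poisson_quot SW K) = GKdim class_ring (poisson_quot SW K)
    \<and> GKdim class_ring (poisson_quot SW K) < \<infinity>"
proof -
  interpret witt_quot K using assms(1,2) by (rule witt_quot.intro)
  obtain f where f: "f \<in> K" "f \<noteq> 0" using assms(3) zero by auto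
  \<comment> \<open>The induction needs some degree bound for \<open>f\<close>; the sum over all its
    monomials is one.\<close>
  have "wdeg (\<lambda>_. 1) m \<le> (\<Sum>m\<in>Poly_Mapping.keys f. wdeg (\<lambda>_. 1) m)"
    if "m \<in> Poly_Mapping.keys f" for m
    by (rule member_le_sum) (use that in auto)
  from poisson_radical_dominated[OF poisson_radical_axioms f this]
  obtain M s C where "dominated K M s C" by blast
  \<comment> \<open>The constants obtained may be 0; enlarging them makes \<open>x_1\<close> and
    \<open>x_2\<close> available as generators and the scale factor positive.\<close>
  hence "dominated K (M + 2) s (C + 1)" by (rule dominated_mono) auto
  from GKdim_PGKdim[OF this] show ?thesis by simp
qed

end
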